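(* Let $G$ be a locally finite connected graph. For a probability measure $\mu$ on $(0,\infty)$, let $\{R(e)\}$, indexed by the edges $e$ of $G$, be i.i.d. positive random variables with common distribution $\mu$, regarded as resistances on the edges of $G$, and consider the random walk in random environment which, given $\{R(e)\}$, is the Markov chain on the vertices of $G$ with transition probabilities $$p(v,w)=\frac{R(vw)^{-1}}{\sum_{z} R(vz)^{-1}}\qquad (w \text{ adjacent to } v),$$ where the sum is over all vertices $z$ adjacent to $v$. (i) If $\int x\,d\mu(x)<\infty$ and simple random walk on $G$ is transient, then almost surely the resistor network $\{R(e)\}$ has finite net resistance to infinity, and hence almost surely the random walk it defines is transient. (ii) The following conditions on $G$ are equivalent: (a) for every probability distribution $\mu$ on $(0,\infty)$, the resistor network $\{R(e)\}$ with i.i.d. resistances of common distribution $\mu$ is almost surely transient; (b) there exists some $p<1$ such that independent bond percolation on $G$ with parameter $p$ contains, with positive probability, a cluster on which simple random walk is transient.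
   Context: A graph is locally finite if every vertex has finite degree. Simple random walk on a graph is the Markov chain which moves at each step from the current vertex to a uniformly chosen neighbor. Given positive resistances $\{R(e)\}$ on the edges of $G$, the resistor network is called transient if the Markov chain with transition probabilities $p(v,w)=R(vw)^{-1}/\sum_z R(vz)^{-1}$ (for $w$ adjacent to $v$) is transient. The (net) resistance of the network from a vertex $v$ to infinity is the infimum of the energies $\sum_e F(e)^2R(e)$ over unit flows $F$ from $v$ to infinity, that is, antisymmetric functions on oriented edges whose net flow out of every vertex other than $v$ is zero (Kirchhoff's node law) and whose net flow out of $v$ is $1$ (the infimum is $+\infty$ if there is no such flow of finite energy). Finiteness of this resistance does not depend on the choice of vertex $v$; the network "has finite net resistance" if the resistance is finite from some (equivalently every) vertex. Independent bond percolation on $G$ with parameter $p\in[0,1]$ retains each edge of $G$ independently with probability $p$ and deletes it otherwise; a cluster is a connected component of the resulting random subgraph (with all vertices of $G$). Simple random walk on a finite cluster, including one consisting of a single isolated vertex, is regarded as recurrent (not transient). "Almost surely" and "with positive probability" refer to the randomness of the resistances and of the percolation configuration, respectively. *)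

theory Defs
  imports "HOL-Probability.Probability"
begin

subsection \<open>Graphs\<close>

definition simple_graph :: "'v set \<Rightarrow> 'v set set \<Rightarrow> bool" where
  "simple_graph V E \<longleftrightarrow> (\<forall>e\<in>E. \<exists>u\<in>V. \<exists>w\<in>V. u \<noteq> w \<and> e = {u, w})"

definition neighbors :: "'v set set \<Rightarrow> 'v \<Rightarrow> 'v set" where
  "neighbors E v = {w. {v, w} \<in> E}"

definition locally_finite :: "'v set \<Rightarrow> 'v set set \<Rightarrow> bool" where
  "locally_finite V E \<longleftrightarrow> (\<forall>v\<in>V. finite (neighbors E v))"

definition joined :: "'v set set \<Rightarrow> 'v \<Rightarrow> 'v \<Rightarrow> bool" where
  "joined E u w \<longleftrightarrow> (u, w) \<in> {(x, y). {x, y} \<in> E}\<^sup>*"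

definition connected_graph :: "'v set \<Rightarrow> 'v set set \<Rightarrow> bool" where
  "connected_graph V E \<longleftrightarrow> V \<noteq> {} \<and> (\<forall>u\<in>V. \<forall>w\<in>V. joined E u w)"

definition clusters :: "'v set \<Rightarrow> 'v set set \<Rightarrow> 'v set set" where
  "clusters V F = (\<lambda>v. {w \<in> V. joined F v w}) ` V"


subsection \<open>Markov chains and transience\<close>

text \<open>The law on trajectories of the Markov chain with transition kernel \<open>K\<close> started at \<open>v\<close>,
  as the Ionescu-Tulcea limit measure.  The defining properties are
  \<open>sets_markov_law\<close>, \<open>prob_space_markov_law\<close> and \<open>markov_law_prefix\<close> below.\<close>

definition markov_step :: "('v \<Rightarrow> 'v pmf) \<Rightarrow> 'v \<Rightarrow> nat \<Rightarrow> (nat \<Rightarrow> 'v) \<Rightarrow> 'v measure" where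
  "markov_step K v n X = measure_pmf (if n = 0 then return_pmf v else K (X (n - 1)))"

definition markov_law :: "('v \<Rightarrow> 'v pmf) \<Rightarrow> 'v \<Rightarrow> (nat \<Rightarrow> 'v) measure" where
  "markov_law K v =
     projective_family.lim UNIV
       (Ionescu_Tulcea.CI (markov_step K v) (\<lambda>_. count_space UNIV))
       (\<lambda>_. count_space UNIV)"

lemma Ionescu_Tulcea_markov_step:
  "Ionescu_Tulcea (markov_step K v) (\<lambda>_. count_space UNIV)"
proof (rule Ionescu_Tulcea.intro)
  fix i :: nat
  show "markov_step K v i \<in> measurable (PiM {0..<i} (\<lambda>_. count_space UNIV)) (subprob_algebra (count_space UNIV))"
  proof (cases i)
    case 0
    then show ?thesis
      by (auto simp: markov_step_def[abs_def] space_subprob_algebra intro!: prob_space_imp_subprob_space measure_pmf.prob_space_axioms)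
  next
    case (Suc j)
    have "(\<lambda>w. measure_pmf (K w)) \<in> measurable (count_space UNIV) (subprob_algebra (count_space UNIV))"
      by (auto simp: space_subprob_algebra intro!: prob_space_imp_subprob_space measure_pmf.prob_space_axioms)
    moreover have "(\<lambda>X. X j) \<in> measurable (PiM {0..<i} (\<lambda>_. count_space UNIV)) (count_space UNIV)"
      using Suc by (intro measurable_component_singleton) auto
    ultimately have "(\<lambda>X. measure_pmf (K (X j))) \<in> measurable (PiM {0..<i} (\<lambda>_. count_space UNIV)) (subprob_algebra (count_space UNIV))"
      by (rule measurable_compose[rotated])
    then show ?thesis
      using Suc by (simp add: markov_step_def[abs_def])
  qed
next
  fix i :: nat and x :: "nat \<Rightarrow> 'a"
  show "prob_space (markov_step K v i x)"
    by (simp add: markov_step_def measure_pmf.prob_space_axioms)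
qed

lemma sets_markov_law: "sets (markov_law K v) = sets (PiM UNIV (\<lambda>_. count_space UNIV))"
proof -
  interpret IT: Ionescu_Tulcea "markov_step K v" "\<lambda>_. count_space UNIV"
    by (rule Ionescu_Tulcea_markov_step)
  show ?thesis
    unfolding markov_law_def by (rule IT.PF.sets_lim)
qed

lemma emeasure_markov_law_prefix:
  "emeasure (markov_law K v) {X. \<forall>i\<le>n. X i = x i} =
     ennreal (if x 0 = v then \<Prod>i<n. pmf (K (x i)) (x (Suc i)) else 0)"
proof -
  let ?M = "\<lambda>_::nat. count_space (UNIV :: 'a set)"
  interpret IT: Ionescu_Tulcea "markov_step K v" ?M
    by (rule Ionescu_Tulcea_markov_step)
  define A where "A n = {restrict x {0..<n}}" for n
  have A[measurable]: "A n \<in> sets (PiM {0..<n} ?M)" for n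
    unfolding A_def PiE_singleton[symmetric, OF restrict_extensional]
    by (intro sets_PiM_I_finite) auto
  have eP: "emeasure (IT.eP n X) (A (Suc n)) =
      emeasure (markov_step K v n (restrict x {0..<n})) {x n} * indicator (A n) X"
    if X: "X \<in> space (PiM {0..<n} ?M)" for n X
  proof -
    have "(\<lambda>y. X(n := y)) -` A (Suc n) = (if X \<in> A n then {x n} else {})"
    proof (cases "X \<in> A n")
      case True
      then have X': "X = restrict x {0..<n}"
        by (simp add: A_def)
      have "X(n := y) = restrict x {0..<Suc n} \<longleftrightarrow> y = x n" for y
        unfolding X' by (auto simp: fun_eq_iff)
      then show ?thesis
        using True by (auto simp: A_def)
    next
      case False
      have "X(n := y) \<noteq> restrict x {0..<Suc n}" for y
      proof
        assume eq: "X(n := y) = restrict x {0..<Suc n}"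
        have "X = restrict x {0..<n}"
        proof
          fix i show "X i = restrict x {0..<n} i"
          proof (cases "i < n")
            case True
            then show ?thesis
              using fun_cong[OF eq, of i] by (auto split: if_splits)
          next
            case False
            then show ?thesis
              using X by (auto simp: space_PiM PiE_def extensional_def)
          qed
        qed
        then show False
          using False by (simp add: A_def)
      qed
      then show ?thesis
        using False by (auto simp: A_def)
    qed
    then show ?thesis
      using IT.emeasure_eP[OF X A[of "Suc n"]] X by (auto simp: A_def split: split_indicator)
  qed
  have C_Suc: "emeasure (IT.C 0 (Suc n) (\<lambda>_. undefined)) (A (Suc n)) =
      emeasure (markov_step K v n (restrict x {0..<n})) {x n} * emeasure (IT.C 0 n (\<lambda>_. undefined)) (A n)" for n
  proof -
    have u: "(\<lambda>_. undefined) \<in> space (PiM {0..<0} ?M)"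
      by (simp add: space_PiM)
    have "emeasure (IT.C 0 (Suc n) (\<lambda>_. undefined)) (A (Suc n)) =
        (\<integral>\<^sup>+X. emeasure (IT.eP n X) (A (Suc n)) \<partial>IT.C 0 n (\<lambda>_. undefined))"
      using IT.space_C[OF u, of n] IT.sets_C[OF u, of n] u
      by (simp, subst emeasure_bind[where N="PiM {0..<Suc n} ?M"])
         (auto intro: IT.measurable_eP A simp: IT.prob_space_C[THEN prob_space.not_empty] 
            measurable_cong_sets[OF IT.sets_C[OF u, of n, simplified] refl] prob_space.not_empty simp del: IT.C.simps)
    also have "\<dots> = (\<integral>\<^sup>+X. emeasure (markov_step K v n (restrict x {0..<n})) {x n} * indicator (A n) X
        \<partial>IT.C 0 n (\<lambda>_. undefined))"
      using IT.space_C[OF u, of n] by (intro nn_integral_cong eP) simp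
    also have "\<dots> = emeasure (markov_step K v n (restrict x {0..<n})) {x n} * emeasure (IT.C 0 n (\<lambda>_. undefined)) (A n)"
      using IT.sets_C[OF u, of n] A[of n] by (intro nn_integral_cmult_indicator) simp
    finally show ?thesis .
  qed
  have C: "emeasure (IT.C 0 (Suc n) (\<lambda>_. undefined)) (A (Suc n)) =
      ennreal (if x 0 = v then \<Prod>i<n. pmf (K (x i)) (x (Suc i)) else 0)"
  proof (induction n)
    case 0
    have "emeasure (IT.C 0 0 (\<lambda>_. undefined)) (A 0) = 1"
      using A[of 0] by (simp add: A_def restrict_def)
    then show ?case
      unfolding C_Suc by (auto simp: markov_step_def emeasure_pmf_single)
  next
    case (Suc n)
    show ?case
      unfolding C_Suc[of "Suc n"] Suc.IH
      by (auto simp: markov_step_def emeasure_pmf_single ennreal_mult[symmetric] prod_nonneg mult.commute)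
  qed
  have "{X. \<forall>i\<le>n. X i = x i} = IT.PF.emb UNIV {0..<Suc n} (A (Suc n))"
    unfolding prod_emb_def A_def space_PiM
    by (auto simp: fun_eq_iff restrict_def less_Suc_eq_le) metis
  then have "emeasure (markov_law K v) {X. \<forall>i\<le>n. X i = x i} = emeasure (IT.CI {0..<Suc n}) (A (Suc n))"
    using IT.lim[OF _ A[of "Suc n"]] by (simp add: markov_law_def)
  also have "\<dots> = emeasure (IT.C 0 (Suc n) (\<lambda>_. undefined)) (A (Suc n))"
    using IT.emeasure_CI[OF subset_refl A[of "Suc n"]] A[of "Suc n", THEN sets.sets_into_space]
    by (simp add: space_PiM prod_emb_id del: IT.C.simps)
  finally show ?thesis
    by (simp only: C)
qed

lemma markov_law_prefix:
  "measure (markov_law K v) {X. \<forall>i\<le>n. X i = x i} =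
     (if x 0 = v then \<Prod>i<n. pmf (K (x i)) (x (Suc i)) else 0)"
  unfolding measure_def emeasure_markov_law_prefix by (simp add: prod_nonneg)

lemma prob_space_markov_law: "prob_space (markov_law K v)"
proof -
  let ?M = "\<lambda>_::nat. count_space (UNIV :: 'a set)"
  interpret IT: Ionescu_Tulcea "markov_step K v" ?M
    by (rule Ionescu_Tulcea_markov_step)
  have "prob_space (distr IT.PF.lim (PiM {} ?M) (\<lambda>x. restrict x {}))"
    using IT.PF.prob_space_P[of "{}"] by (simp add: IT.distr_lim)
  then show ?thesis
    unfolding markov_law_def
    by (rule prob_space_distrD[rotated])
       (simp add: measurable_cong_sets[OF IT.PF.sets_lim refl] measurable_restrict)
qed

definition transient_state :: "('v \<Rightarrow> 'v pmf) \<Rightarrow> 'v \<Rightarrow> bool" where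
  "transient_state K v \<longleftrightarrow> measure (markov_law K v) {X. \<exists>n\<ge>1. X n = v} < 1"

lemma return_event_measurable: "{X. \<exists>n\<ge>1. X n = v} \<in> sets (markov_law K v)"
proof -
  have "{X \<in> space (PiM UNIV (\<lambda>_::nat. count_space UNIV)). \<exists>n\<ge>1. X n = v}
      \<in> sets (PiM UNIV (\<lambda>_::nat. count_space UNIV))"
    by measurable
  then show ?thesis
    by (simp add: sets_markov_law space_PiM)
qed

definition transient_chain :: "'v set \<Rightarrow> ('v \<Rightarrow> 'v pmf) \<Rightarrow> bool" where
  "transient_chain V K \<longleftrightarrow> (\<forall>v\<in>V. transient_state K v)"


subsection \<open>Simple random walk and resistor networks\<close>

text \<open>At an isolated vertex a walk has nowhere to go and stays put, so that it is recurrent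
  there.\<close>

definition simple_walk :: "'v set set \<Rightarrow> 'v \<Rightarrow> 'v pmf" where
  "simple_walk E v =
     (if neighbors E v = {} then return_pmf v else pmf_of_set (neighbors E v))"

definition simple_walk_transient :: "'v set \<Rightarrow> 'v set set \<Rightarrow> bool" where
  "simple_walk_transient V E \<longleftrightarrow> transient_chain V (simple_walk E)"

definition network_prob :: "'v set set \<Rightarrow> ('v set \<Rightarrow> real) \<Rightarrow> 'v \<Rightarrow> 'v \<Rightarrow> real" where
  "network_prob E R v w =
     (if w \<in> neighbors E v
      then inverse (R {v, w}) / (\<Sum>z\<in>neighbors E v. inverse (R {v, z})) else 0)"

definition network_walk :: "'v set set \<Rightarrow> ('v set \<Rightarrow> real) \<Rightarrow> 'v \<Rightarrow> 'v pmf" where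
  "network_walk E R v =
     (if neighbors E v = {} then return_pmf v else embed_pmf (network_prob E R v))"

lemma pmf_network_walk:
  assumes "finite (neighbors E v)" "neighbors E v \<noteq> {}"
    and "\<And>e. e \<in> E \<Longrightarrow> 0 < R e"
  shows "pmf (network_walk E R v) w = network_prob E R v w"
proof -
  define S where "S = (\<Sum>z\<in>neighbors E v. inverse (R {v, z}))"
  have pos: "0 < R {v, z}" if "z \<in> neighbors E v" for z
    using that assms(3) by (auto simp: neighbors_def)
  have S: "0 < S"
    unfolding S_def using assms(1,2) pos by (intro sum_pos) auto
  have nonneg: "0 \<le> network_prob E R v z" for z
    using S pos[of z] by (auto simp: network_prob_def S_def[symmetric] intro!: divide_nonneg_pos less_imp_le)
  have "(\<integral>\<^sup>+z. ennreal (network_prob E R v z) \<partial>count_space UNIV) =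
      (\<Sum>z\<in>neighbors E v. ennreal (network_prob E R v z))"
    using assms(1) by (intro nn_integral_count_space') (auto simp: network_prob_def)
  also have "\<dots> = ennreal (\<Sum>z\<in>neighbors E v. network_prob E R v z)"
    by (intro sum_ennreal nonneg)
  also have "(\<Sum>z\<in>neighbors E v. network_prob E R v z) = S / S"
    by (simp add: network_prob_def S_def[symmetric] sum_divide_distrib[symmetric])
  also have "\<dots> = 1"
    using S by simp
  finally show ?thesis
    using assms(2) nonneg by (simp add: network_walk_def pmf_embed_pmf)
qed

definition network_transient :: "'v set \<Rightarrow> 'v set set \<Rightarrow> ('v set \<Rightarrow> real) \<Rightarrow> bool" where
  "network_transient V E R \<longleftrightarrow> transient_chain V (network_walk E R)"


subsection \<open>Resistance to infinity\<close>

definition unit_flow ::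
  "'v set \<Rightarrow> 'v set set \<Rightarrow> 'v \<Rightarrow> ('v \<Rightarrow> 'v \<Rightarrow> real) \<Rightarrow> bool" where
  "unit_flow V E v F \<longleftrightarrow>
     (\<forall>x y. {x, y} \<notin> E \<longrightarrow> F x y = 0) \<and>
     (\<forall>x y. F y x = - F x y) \<and>
     (\<forall>x\<in>V. (\<Sum>y\<in>neighbors E x. F x y) = (if x = v then 1 else 0))"

text \<open>The sum runs over oriented edges, so every edge is counted twice; hence the factor
  one half.\<close>

definition energy ::
  "'v set set \<Rightarrow> ('v set \<Rightarrow> real) \<Rightarrow> ('v \<Rightarrow> 'v \<Rightarrow> real) \<Rightarrow> ennreal" where
  "energy E R F =
     (\<integral>\<^sup>+ (x, y). ennreal ((F x y)\<^sup>2 * R {x, y}) \<partial>count_space {(x, y). {x, y} \<in> E}) / 2"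

definition net_resistance ::
  "'v set \<Rightarrow> 'v set set \<Rightarrow> ('v set \<Rightarrow> real) \<Rightarrow> 'v \<Rightarrow> ennreal" where
  "net_resistance V E R v = (INF F\<in>{F. unit_flow V E v F}. energy E R F)"

definition finite_net_resistance :: "'v set \<Rightarrow> 'v set set \<Rightarrow> ('v set \<Rightarrow> real) \<Rightarrow> bool" where
  "finite_net_resistance V E R \<longleftrightarrow> (\<exists>v\<in>V. net_resistance V E R v < \<infinity>)"


subsection \<open>Random resistances and bond percolation\<close>

text \<open>A probability measure on the positive half-line is represented as a Borel probability
  measure on the reals giving the complement measure zero.  The random environment is the
  canonical i.i.d. family, that is, the coordinates of the product space.\<close>

definition positive_distribution :: "real measure \<Rightarrow> bool" where
  "positive_distribution \<mu> \<longleftrightarrow> real_distribution \<mu> \<and> (AE x in \<mu>. 0 < x)"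

definition iid_resistances :: "'v set set \<Rightarrow> real measure \<Rightarrow> ('v set \<Rightarrow> real) measure" where
  "iid_resistances E \<mu> = PiM E (\<lambda>_. \<mu>)"

definition bond_percolation :: "'v set set \<Rightarrow> real \<Rightarrow> ('v set \<Rightarrow> bool) measure" where
  "bond_percolation E p = PiM E (\<lambda>_. measure_pmf (bernoulli_pmf p))"

definition open_edges :: "'v set set \<Rightarrow> ('v set \<Rightarrow> bool) \<Rightarrow> 'v set set" where
  "open_edges E \<omega> = {e \<in> E. \<omega> e}"

definition has_transient_cluster :: "'v set \<Rightarrow> 'v set set \<Rightarrow> bool" where
  "has_transient_cluster V F \<longleftrightarrow>
     (\<exists>C\<in>clusters V F. simple_walk_transient C {e \<in> F. e \<subseteq> C})"

end

theory Submission
  imports Defs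
begin

text \<open>
The proof rests on the equivalence, at each vertex \<open>v\<close> of a locally finite network, of three
conditions: the walk is transient at \<open>v\<close>; there is a unit flow from \<open>v\<close> to infinity of finite energy;
and the capacity of \<open>v\<close> is positive, that is, the Dirichlet energies of finitely supported rational
functions with value \<open>1\<close> at \<open>v\<close> are bounded away from zero.  The link between the walk and
the network are the probabilities \<open>hit v n\<close> of visiting \<open>v\<close> within \<open>n\<close> steps.  At a recurrent vertex
these probabilities, as functions of the starting point, have energies tending to zero
(\<open>recurrent_imp_small_dirichlet\<close>); at a transient vertex the gradient of their limit is the desired
flow (\<open>transient_imp_flow\<close>); and a flow bounds Dirichlet energies from below by the Cauchy-Schwarz
inequality (\<open>flow_imp_positive_capacity\<close>).

Flows are suited to part (i): the energy of a fixed flow is linear in the resistances, so it has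
finite mean when the resistances do (\<open>finite_mean_resistance\<close>).

Capacities are suited to part (ii): they are monotone in the network, they involve only countably
many test functions, each of which sees finitely many edges, and their positivity is not affected by
finitely many resistances, so that it obeys a zero-one law.  If percolation with parameter \<open>p < 1\<close>
has a transient cluster, then such a percolation is found inside the set of edges of resistance at
most \<open>M\<close>, for \<open>M\<close> large (\<open>percolation_imp_transient\<close>).  If no percolation with parameter less than
\<open>1\<close> has one, then a distribution with a sufficiently heavy tail, assembled from finitely many test
functions at each level, gives a recurrent network (\<open>transient_imp_percolation\<close>).
\<close>

section \<open>Escape probabilities of a Markov chain\<close>

text \<open>The probability that the walk started at \<open>x\<close> is not at \<open>v\<close> at any of the times \<open>1\<close> to \<open>n\<close>.  Time \<open>0\<close> does
not count, so that for \<open>x = v\<close> it is the probability of not having returned.\<close>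

fun avoid_prob :: "('v \<Rightarrow> 'v pmf) \<Rightarrow> 'v \<Rightarrow> nat \<Rightarrow> 'v \<Rightarrow> real" where
  "avoid_prob K v 0 x = 1"
| "avoid_prob K v (Suc n) x = (\<Sum>y\<in>set_pmf (K x) - {v}. pmf (K x) y * avoid_prob K v n y)"

lemma sum_pmf_support:
  assumes "finite (set_pmf p)"
  shows "(\<Sum>y\<in>set_pmf p. pmf p y) = 1"
  using assms sum_pmf_eq_1 by blast

lemma avoid_bounds:
  assumes fin: "\<And>x. finite (set_pmf (K x))"
  shows "0 \<le> avoid_prob K v n x \<and> avoid_prob K v n x \<le> 1"
proof (induction n arbitrary: x)
  case (Suc n)
  have "(\<Sum>y\<in>set_pmf (K x) - {v}. pmf (K x) y * avoid_prob K v n y) \<le> (\<Sum>y\<in>set_pmf (K x) - {v}. pmf (K x) y)"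
    using Suc by (intro sum_mono) (simp add: mult_left_le)
  also have "\<dots> \<le> (\<Sum>y\<in>set_pmf (K x). pmf (K x) y)"
    using fin by (intro sum_mono2) auto
  finally show ?case
    using Suc fin by (auto simp: sum_pmf_support intro!: sum_nonneg)
qed simp

lemma avoid_Suc_le:
  assumes fin: "\<And>x. finite (set_pmf (K x))"
  shows "avoid_prob K v (Suc n) x \<le> avoid_prob K v n x"
proof (induction n arbitrary: x)
  case 0
  show ?case using avoid_bounds[where K=K and v=v and n="Suc 0" and x=x, OF fin] by simp
next
  case (Suc n)
  show ?case
    unfolding avoid_prob.simps(2)[of K v "Suc n"] avoid_prob.simps(2)[of K v n]
    using Suc by (intro sum_mono mult_left_mono) auto
qed

lemma prefix_set_measurable: "{X. \<forall>i\<le>n. X i = x i} \<in> sets (markov_law K v)"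
proof -
  have "{X \<in> space (PiM UNIV (\<lambda>_::nat. count_space UNIV)). \<forall>i\<in>{..n}. X i = x i}
      \<in> sets (PiM UNIV (\<lambda>_::nat. count_space UNIV))"
    by measurable
  then show ?thesis
    by (simp add: sets_markov_law space_PiM Ball_def)
qed

lemma avoid_set_measurable:
  "{X. (\<forall>i\<le>n. X i = x i) \<and> (\<forall>j. n < j \<and> j \<le> n + m \<longrightarrow> X j \<noteq> v)} \<in> sets (markov_law K w)"
proof -
  have "{X \<in> space (PiM UNIV (\<lambda>_::nat. count_space UNIV)). (\<forall>i\<in>{..n}. X i = x i) \<and> (\<forall>j\<in>{n<..n+m}. X j \<noteq> v)}
      \<in> sets (PiM UNIV (\<lambda>_::nat. count_space UNIV))"
    by measurable
  then show ?thesis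
    by (simp add: sets_markov_law space_PiM Ball_def)
qed

text \<open>The law of the chain is only known through its finite-dimensional distributions, so the Markov
property is obtained here by induction over cylinders: conditioning on one more step splits the
event according to the next state, and the remaining walk has one step less.\<close>

lemma measure_avoid_after_prefix:
  assumes fin: "\<And>x. finite (set_pmf (K x))"
  shows "measure (markov_law K w) {X. (\<forall>i\<le>n. X i = x i) \<and> (\<forall>j. n < j \<and> j \<le> n + m \<longrightarrow> X j \<noteq> v)} =
    measure (markov_law K w) {X. \<forall>i\<le>n. X i = x i} * avoid_prob K v m (x n)"
proof (induction m arbitrary: n x)
  case 0
  have "{X. (\<forall>i\<le>n. X i = x i) \<and> (\<forall>j. n < j \<and> j \<le> n + 0 \<longrightarrow> X j \<noteq> v)} = {X. \<forall>i\<le>n. X i = x i}"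
    by auto
  then show ?case by simp
next
  case (Suc m)
  interpret prob_space "markov_law K w" by (rule prob_space_markov_law)
  let ?P = "markov_law K w"
  define A where "A n m x = {X. (\<forall>i\<le>n. X i = x i) \<and> (\<forall>j. n < j \<and> j \<le> n + m \<longrightarrow> X j \<noteq> v)}" for n m and x :: "nat \<Rightarrow> 'a"
  define C where "C n x = {X. \<forall>i\<le>n. X i = x i}" for n and x :: "nat \<Rightarrow> 'a"
  define S where "S = set_pmf (K (x n))"
  define u where "u y = x(Suc n := y)" for y
  have A_sets: "A n m x \<in> sets ?P" for n m x
    unfolding A_def by (rule avoid_set_measurable)
  have C_sets: "C n x \<in> sets ?P" for n x
    unfolding C_def by (rule prefix_set_measurable)
  have finS: "finite S" using fin by (simp add: S_def)
  have IH: "measure ?P (A n m x) = measure ?P (C n x) * avoid_prob K v m (x n)" for n x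
    using Suc unfolding A_def C_def by blast
  have Cu: "measure ?P (C (Suc n) (u y)) = measure ?P (C n x) * pmf (K (x n)) y" for y
    unfolding C_def markov_law_prefix by (simp add: u_def)
  have C_less: "X i = x i" if "X \<in> C (Suc n) (u y)" "i \<le> n" for X i y
    using that by (auto simp: C_def u_def split: if_splits)
  have C_last: "X (Suc n) = y" if "X \<in> C (Suc n) (u y)" for X y
    using that by (auto simp: C_def u_def)
  have CuI: "X \<in> C (Suc n) (u (X (Suc n)))" if "X \<in> C n x" for X
    using that by (auto simp: C_def u_def le_Suc_eq)
  have A_eq: "A n m x = C n x \<inter> {X. \<forall>j. n < j \<and> j \<le> n + m \<longrightarrow> X j \<noteq> v}" for n m x
    by (auto simp: A_def C_def)
  \<comment> \<open>The state space may be uncountable, so the steps that leave the support of the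
    kernel are discarded first.\<close>
  have null: "measure ?P (C n x - (\<Union>y\<in>S. C (Suc n) (u y))) = 0"
  proof -
    have sub: "(\<Union>y\<in>S. C (Suc n) (u y)) \<subseteq> C n x"
      using C_less by (auto simp: C_def[of n x])
    have "measure ?P (\<Union>y\<in>S. C (Suc n) (u y)) = (\<Sum>y\<in>S. measure ?P (C (Suc n) (u y)))"
      using finS C_sets by (intro finite_measure_finite_Union) (auto simp: disjoint_family_on_def dest: C_last)
    also have "\<dots> = measure ?P (C n x)"
      unfolding Cu sum_distrib_left[symmetric] using fin by (simp add: S_def sum_pmf_support)
    finally show ?thesis
      using sub finS C_sets by (subst finite_measure_Diff) auto
  qed
  have sub1: "(\<Union>y\<in>S - {v}. A (Suc n) m (u y)) \<subseteq> A n (Suc m) x"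
  proof
    fix X assume "X \<in> (\<Union>y\<in>S - {v}. A (Suc n) m (u y))"
    then obtain y where y: "y \<in> S" "y \<noteq> v" and X: "X \<in> A (Suc n) m (u y)" by blast
    then have XC: "X \<in> C (Suc n) (u y)" by (auto simp: A_eq)
    have "X j \<noteq> v" if "n < j" "j \<le> n + Suc m" for j
    proof (cases "j = Suc n")
      case True then show ?thesis using C_last[OF XC] y by simp
    next
      case False then show ?thesis using X that by (auto simp: A_def)
    qed
    then show "X \<in> A n (Suc m) x"
      using C_less[OF XC] by (auto simp: A_def)
  qed
  have sub2: "A n (Suc m) x \<subseteq> (\<Union>y\<in>S - {v}. A (Suc n) m (u y)) \<union> (C n x - (\<Union>y\<in>S. C (Suc n) (u y)))"
  proof
    fix X assume X: "X \<in> A n (Suc m) x"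
    then have XC: "X \<in> C n x" by (auto simp: A_eq)
    have nv: "X (Suc n) \<noteq> v" using X by (auto simp: A_def)
    have "X \<in> A (Suc n) m (u (X (Suc n)))"
      using CuI[OF XC] X by (auto simp: A_eq)
    then show "X \<in> (\<Union>y\<in>S - {v}. A (Suc n) m (u y)) \<union> (C n x - (\<Union>y\<in>S. C (Suc n) (u y)))"
      using XC nv by (cases "X (Suc n) \<in> S") (auto dest: C_last)
  qed
  have "measure ?P (A n (Suc m) x) = measure ?P (\<Union>y\<in>S - {v}. A (Suc n) m (u y))"
  proof (rule antisym)
    have "measure ?P (A n (Suc m) x) \<le> measure ?P ((\<Union>y\<in>S - {v}. A (Suc n) m (u y)) \<union> (C n x - (\<Union>y\<in>S. C (Suc n) (u y))))"
      using sub2 finS A_sets C_sets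
      by (intro finite_measure_mono sets.Un sets.Diff sets.finite_UN) simp_all
    also have "\<dots> \<le> measure ?P (\<Union>y\<in>S - {v}. A (Suc n) m (u y)) + measure ?P (C n x - (\<Union>y\<in>S. C (Suc n) (u y)))"
      using finS A_sets C_sets
      by (intro measure_Un_le sets.Diff sets.finite_UN) simp_all
    finally show "measure ?P (A n (Suc m) x) \<le> measure ?P (\<Union>y\<in>S - {v}. A (Suc n) m (u y))"
      using null by simp
  qed (use sub1 A_sets finS in \<open>auto intro!: finite_measure_mono\<close>)
  also have "\<dots> = (\<Sum>y\<in>S - {v}. measure ?P (A (Suc n) m (u y)))"
  proof (intro finite_measure_finite_Union)
    show "disjoint_family_on (\<lambda>y. A (Suc n) m (u y)) (S - {v})"
      by (auto simp: disjoint_family_on_def A_eq dest: C_last)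
  qed (use finS A_sets in blast)+
  also have "\<dots> = (\<Sum>y\<in>S - {v}. measure ?P (C n x) * (pmf (K (x n)) y * avoid_prob K v m y))"
    unfolding IH Cu by (simp add: u_def mult.assoc)
  also have "\<dots> = measure ?P (C n x) * avoid_prob K v (Suc m) (x n)"
    by (simp add: sum_distrib_left S_def)
  finally show ?case unfolding A_def C_def .
qed

text \<open>The events of not having returned by time \<open>n\<close> decrease to the event of never returning, so
transience is a uniform lower bound for their probabilities.  In this form it only involves the
finite sums that define \<open>avoid_prob\<close>.\<close>

lemma transient_state_iff_avoid:
  fixes K :: "'v \<Rightarrow> 'v pmf"
  assumes fin: "\<And>x. finite (set_pmf (K x))"
  shows "transient_state K v \<longleftrightarrow> (\<exists>\<epsilon>>0. \<forall>n. \<epsilon> \<le> avoid_prob K v n v)"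
proof -
  interpret prob_space "markov_law K v" by (rule prob_space_markov_law)
  let ?P = "markov_law K v"
  define A where "A m = {X :: nat \<Rightarrow> 'v. (\<forall>i\<le>0. X i = v) \<and> (\<forall>j. 0 < j \<and> j \<le> 0 + m \<longrightarrow> X j \<noteq> v)}" for m
  have A_sets: "A m \<in> sets ?P" for m
    unfolding A_def by (rule avoid_set_measurable)
  have pA: "measure ?P (A m) = avoid_prob K v m v" for m
    unfolding A_def using measure_avoid_after_prefix[where K=K and w=v and n=0 and x="\<lambda>_. v" and m=m and v=v, OF fin] markov_law_prefix[of K v 0 "\<lambda>_. v"]
    by simp
  have start: "measure ?P {X. X 0 = v} = 1"
    using markov_law_prefix[of K v 0 "\<lambda>_. v"] by simp
  have start_sets: "{X. X 0 = v} \<in> sets ?P"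
    using prefix_set_measurable[of 0 "\<lambda>_. v" K v] by simp
  have sp: "space ?P = UNIV"
    using sets_eq_imp_space_eq[OF sets_markov_law[of K v]] by (simp add: space_PiM)
  let ?H = "{X. \<exists>n\<ge>1. X n = v}"
  have H_sets: "?H \<in> sets ?P" by (rule return_event_measurable)
  have AE0: "AE X in ?P. X 0 = v"
    using start start_sets sp by (subst prob_Collect_eq_1[symmetric]) auto
  have "(\<lambda>m. measure ?P (A m)) \<longlonglongrightarrow> measure ?P (\<Inter>m. A m)"
    using A_sets by (intro finite_Lim_measure_decseq) (force simp: decseq_def A_def)+
  also have "measure ?P (\<Inter>m. A m) = measure ?P (UNIV - ?H)"
  proof (rule finite_measure_eq_AE)
    show "AE X in ?P. (X \<in> (\<Inter>m. A m)) = (X \<in> UNIV - ?H)"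
      using AE0 by eventually_elim (fastforce simp: A_def Suc_le_eq)
  next
    show "(\<Inter>m. A m) \<in> sets ?P" using A_sets by auto
    show "UNIV - ?H \<in> sets ?P" using sets.compl_sets[OF H_sets] sp by simp
  qed
  also have "\<dots> = 1 - measure ?P ?H"
    using prob_compl[OF H_sets] sp by simp
  finally have lim: "(\<lambda>m. avoid_prob K v m v) \<longlonglongrightarrow> 1 - measure ?P ?H"
    by (simp add: pA)
  have dec: "decseq (\<lambda>m. avoid_prob K v m v)"
    by (rule decseq_SucI) (rule avoid_Suc_le[OF fin])
  show ?thesis
  proof
    assume "transient_state K v"
    then have "0 < 1 - measure ?P ?H" by (simp add: transient_state_def)
    then show "\<exists>\<epsilon>>0. \<forall>n. \<epsilon> \<le> avoid_prob K v n v"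
      using decseq_ge[OF dec lim] by blast
  next
    assume "\<exists>\<epsilon>>0. \<forall>n. \<epsilon> \<le> avoid_prob K v n v"
    then obtain \<epsilon> where e: "\<epsilon> > 0" "\<And>n. \<epsilon> \<le> avoid_prob K v n v" by blast
    then have "\<epsilon> \<le> 1 - measure ?P ?H"
      by (intro LIMSEQ_le_const[OF lim]) auto
    with e show "transient_state K v" by (simp add: transient_state_def)
  qed
qed

section \<open>Dirichlet sums and flows\<close>

text \<open>The Dirichlet energy of \<open>f\<close>, counted over oriented edges and hence twice.  Only finitely supported
\<open>f\<close> on locally finite graphs occur, for which the sum is finite.\<close>

definition dirichlet :: "'v set set \<Rightarrow> ('v set \<Rightarrow> real) \<Rightarrow> ('v \<Rightarrow> real) \<Rightarrow> real" where
  "dirichlet E R f = (\<Sum>(x, y) | {x, y} \<in> E \<and> f x \<noteq> f y. (f x - f y)\<^sup>2 / R {x, y})"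

text \<open>Rational values keep the family countable, which makes capacities measurable in a random
environment and lets the family be enumerated.\<close>

definition test_functions :: "'v set \<Rightarrow> 'v \<Rightarrow> ('v \<Rightarrow> real) set" where
  "test_functions V v = {f. finite {x. f x \<noteq> 0} \<and> {x. f x \<noteq> 0} \<subseteq> V \<and> f v = 1 \<and> range f \<subseteq> \<rat>}"

definition positive_capacity :: "'v set \<Rightarrow> 'v set set \<Rightarrow> ('v set \<Rightarrow> real) \<Rightarrow> 'v \<Rightarrow> bool" where
  "positive_capacity V E R v \<longleftrightarrow> (\<exists>\<epsilon>>0. \<forall>f\<in>test_functions V v. \<epsilon> \<le> dirichlet E R f)"

definition finite_energy_flow :: "'v set \<Rightarrow> 'v set set \<Rightarrow> ('v set \<Rightarrow> real) \<Rightarrow> 'v \<Rightarrow> bool" where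
  "finite_energy_flow V E R v \<longleftrightarrow> (\<exists>F. unit_flow V E v F \<and> energy E R F < \<infinity>)"

lemma net_resistance_finite_iff:
  "net_resistance V E R v < \<infinity> \<longleftrightarrow> finite_energy_flow V E R v"
  by (auto simp: net_resistance_def finite_energy_flow_def INF_less_iff)

definition arcs_at :: "'v set set \<Rightarrow> 'v set \<Rightarrow> ('v \<times> 'v) set" where
  "arcs_at E S = {(x, y). {x, y} \<in> E \<and> (x \<in> S \<or> y \<in> S)}"

locale lf_graph =
  fixes V :: "'v set" and E :: "'v set set"
  assumes simple: "simple_graph V E" and lf: "locally_finite V E"
begin

lemma edge_vertices: "{x, y} \<in> E \<Longrightarrow> x \<in> V \<and> y \<in> V \<and> x \<noteq> y"
  using simple unfolding simple_graph_def by (metis doubleton_eq_iff)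

lemma neighbors_outside: "x \<notin> V \<Longrightarrow> neighbors E x = {}"
  using edge_vertices by (auto simp: neighbors_def)

lemma finite_neighbors: "finite (neighbors E x)"
  using lf neighbors_outside by (cases "x \<in> V") (auto simp: locally_finite_def)

lemma finite_arcs_at:
  assumes "finite S"
  shows "finite (arcs_at E S)"
proof -
  have "arcs_at E S \<subseteq> (SIGMA x:S. neighbors E x) \<union> prod.swap ` (SIGMA x:S. neighbors E x)"
    by (auto simp: arcs_at_def neighbors_def insert_commute image_iff)
  then show ?thesis
    using assms finite_neighbors by (meson finite_SigmaI finite_UnI finite_imageI finite_subset)
qed

lemma dirichlet_eq_sum:
  assumes "finite T" "T \<subseteq> {(x, y). {x, y} \<in> E}"
    and "\<And>x y. {x, y} \<in> E \<Longrightarrow> f x \<noteq> f y \<Longrightarrow> (x, y) \<in> T"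
  shows "dirichlet E R f = (\<Sum>(x, y)\<in>T. (f x - f y)\<^sup>2 / R {x, y})"
  unfolding dirichlet_def using assms by (intro sum.mono_neutral_left) auto

lemma dirichlet_arcs_at:
  assumes "finite S" "\<And>x. x \<notin> S \<Longrightarrow> f x = 0"
  shows "dirichlet E R f = (\<Sum>(x, y)\<in>arcs_at E S. (f x - f y)\<^sup>2 / R {x, y})"
proof (rule dirichlet_eq_sum)
  show "(x, y) \<in> arcs_at E S" if "{x, y} \<in> E" "f x \<noteq> f y" for x y
  proof -
    have "x \<in> S \<or> y \<in> S"
    proof (rule ccontr)
      assume "\<not> (x \<in> S \<or> y \<in> S)"
      then have "f x = 0" "f y = 0" using assms(2)[of x] assms(2)[of y] by simp_all
      with that show False by simp
    qed
    with that show ?thesis by (simp add: arcs_at_def)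
  qed
qed (use finite_arcs_at[OF assms(1)] in \<open>auto simp: arcs_at_def\<close>)

text \<open>Pairing a flow \<open>\<theta>\<close> with a gradient gives the pairing of its divergence with the potential.  It is
used for a unit flow, where it yields a lower bound on Dirichlet energies, and for the gradient
flow of the hitting probabilities, where it computes their energy.\<close>

lemma summation_by_parts:
  assumes S: "finite S" "\<And>x. x \<notin> S \<Longrightarrow> f x = 0"
    and anti: "\<And>x y. \<theta> y x = - \<theta> x (y :: 'v)"
  shows "(\<Sum>(x, y)\<in>arcs_at E S. \<theta> x y * (f x - f y)) = (2 :: real) * (\<Sum>x\<in>S. f x * (\<Sum>y\<in>neighbors E x. \<theta> x y))"
proof -
  let ?T = "arcs_at E S"
  have S': "x \<in> S" if "f x \<noteq> 0" for x using S(2) that by blast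
  have fin: "finite ?T" using S(1) by (rule finite_arcs_at)
  have "(\<Sum>(x, y)\<in>?T. \<theta> x y * f y) = (\<Sum>(x, y)\<in>?T. \<theta> y x * f x)"
    by (rule sum.reindex_bij_witness[of _ prod.swap prod.swap]) (auto simp: arcs_at_def insert_commute)
  also have "\<dots> = - (\<Sum>(x, y)\<in>?T. \<theta> x y * f x)"
    unfolding sum_negf[symmetric] by (intro sum.cong refl) (clarsimp, subst anti, simp)
  finally have swap: "(\<Sum>(x, y)\<in>?T. \<theta> x y * f y) = - (\<Sum>(x, y)\<in>?T. \<theta> x y * f x)" .
  have "(\<Sum>(x, y)\<in>?T. \<theta> x y * (f x - f y)) = (\<Sum>(x, y)\<in>?T. \<theta> x y * f x) - (\<Sum>(x, y)\<in>?T. \<theta> x y * f y)"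
    unfolding sum_subtractf[symmetric] by (intro sum.cong) (auto simp: algebra_simps)
  also have "\<dots> = 2 * (\<Sum>(x, y)\<in>?T. \<theta> x y * f x)"
    using swap by simp
  also have "(\<Sum>(x, y)\<in>?T. \<theta> x y * f x) = (\<Sum>(x, y)\<in>(SIGMA x:S. neighbors E x). \<theta> x y * f x)"
    using fin by (intro sum.mono_neutral_right) (auto simp: arcs_at_def neighbors_def dest: S')
  also have "\<dots> = (\<Sum>x\<in>S. f x * (\<Sum>y\<in>neighbors E x. \<theta> x y))"
    using S(1) finite_neighbors by (subst sum.Sigma[symmetric]) (auto simp: sum_distrib_left mult.commute)
  finally show ?thesis .
qed

end

locale resistor_network = lf_graph +
  fixes R :: "'v set \<Rightarrow> real"
  assumes R_pos: "\<And>e. e \<in> E \<Longrightarrow> 0 < R e"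
begin

definition conductance :: "'v \<Rightarrow> 'v \<Rightarrow> real" where
  "conductance x y = (if {x, y} \<in> E then inverse (R {x, y}) else 0)"

definition total_conductance :: "'v \<Rightarrow> real" where
  "total_conductance x = (\<Sum>y\<in>neighbors E x. conductance x y)"

abbreviation "K \<equiv> network_walk E R"

lemma conductance_sym: "conductance x y = conductance y x"
  by (simp add: conductance_def insert_commute)

lemma conductance_nonneg: "0 \<le> conductance x y"
  using R_pos by (auto simp: conductance_def intro: less_imp_le)

lemma total_conductance_pos: "neighbors E x \<noteq> {} \<Longrightarrow> 0 < total_conductance x"
  unfolding total_conductance_def using finite_neighbors R_pos
  by (intro sum_pos) (auto simp: conductance_def neighbors_def)

lemma total_conductance_nonneg: "0 \<le> total_conductance x"
  unfolding total_conductance_def by (intro sum_nonneg conductance_nonneg)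

lemma pmf_K: "neighbors E x \<noteq> {} \<Longrightarrow> pmf (K x) y = conductance x y / total_conductance x"
  using pmf_network_walk[of E x R y] finite_neighbors[of x] R_pos
  by (auto simp: network_prob_def total_conductance_def conductance_def neighbors_def intro!: arg_cong2[where f="(/)"] sum.cong)

lemma K_isolated: "neighbors E x = {} \<Longrightarrow> K x = return_pmf x"
  by (simp add: network_walk_def)

lemma set_pmf_K: "set_pmf (K x) = (if neighbors E x = {} then {x} else neighbors E x)"
proof (cases "neighbors E x = {}")
  case False
  then have "pmf (K x) y \<noteq> 0 \<longleftrightarrow> y \<in> neighbors E x" for y
    using pmf_K[of x y] total_conductance_pos[of x] R_pos[of "{x, y}"] by (auto simp: conductance_def neighbors_def)
  then show ?thesis using False by (auto simp: set_pmf_eq)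
qed (simp add: K_isolated)

lemma finite_K: "finite (set_pmf (K x))"
  using finite_neighbors by (simp add: set_pmf_K)

lemma dirichlet_nonneg: "0 \<le> dirichlet E R f"
  unfolding dirichlet_def using R_pos by (intro sum_nonneg) (auto intro!: divide_nonneg_pos)

text \<open>The probability of visiting \<open>v\<close> within \<open>n\<close> steps, time \<open>0\<close> included, is the potential from which both
the small Dirichlet energies (at a recurrent vertex) and the flow to infinity (at a transient
one) are built.\<close>

definition hit :: "'v \<Rightarrow> nat \<Rightarrow> 'v \<Rightarrow> real" where
  "hit v n x = (if x = v then 1 else 1 - avoid_prob K v n x)"

lemma avoid_Suc_hit: "avoid_prob K v (Suc n) x = 1 - (\<Sum>y\<in>set_pmf (K x). pmf (K x) y * hit v n y)"
proof -
  have "(\<Sum>y\<in>set_pmf (K x). pmf (K x) y * hit v n y) =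
      (\<Sum>y\<in>set_pmf (K x). pmf (K x) y - (if y = v then 0 else pmf (K x) y * avoid_prob K v n y))"
    by (intro sum.cong) (auto simp: hit_def algebra_simps)
  also have "\<dots> = 1 - (\<Sum>y\<in>set_pmf (K x). if y = v then 0 else pmf (K x) y * avoid_prob K v n y)"
    using finite_K by (simp add: sum_subtractf sum_pmf_support)
  also have "(\<Sum>y\<in>set_pmf (K x). if y = v then 0 else pmf (K x) y * avoid_prob K v n y) = avoid_prob K v (Suc n) x"
    unfolding avoid_prob.simps using finite_K by (intro sum.mono_neutral_cong_right) auto
  finally show ?thesis by simp
qed

lemma hit_Suc: "x \<noteq> v \<Longrightarrow> hit v (Suc n) x = (\<Sum>y\<in>set_pmf (K x). pmf (K x) y * hit v n y)"
  using avoid_Suc_hit[of v n x] by (simp add: hit_def)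

lemma hit_bounds: "0 \<le> hit v n x \<and> hit v n x \<le> 1"
  using avoid_bounds[where K=K and v=v and n=n and x=x, OF finite_K] by (simp add: hit_def)

lemma hit_mono: "hit v n x \<le> hit v (Suc n) x"
  using avoid_Suc_le[where K=K and v=v and n=n and x=x, OF finite_K] by (simp add: hit_def)

text \<open>In \<open>n\<close> steps the walk reaches \<open>v\<close> only from the ball of radius \<open>n\<close>, which is finite.\<close>

lemma finite_hit_support: "finite {x. hit v n x \<noteq> 0} \<and> {x. hit v n x \<noteq> 0} \<subseteq> insert v V"
proof (induction n)
  case 0
  have "{x. hit v 0 x \<noteq> 0} \<subseteq> {v}" by (auto simp: hit_def split: if_splits)
  then show ?case using finite_subset by blast
next
  case (Suc n)
  let ?S = "{x. hit v n x \<noteq> 0}"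
  have "{x. hit v (Suc n) x \<noteq> 0} \<subseteq> insert v (?S \<union> (\<Union>y\<in>?S. neighbors E y))"
  proof
    fix x assume x: "x \<in> {x. hit v (Suc n) x \<noteq> 0}"
    show "x \<in> insert v (?S \<union> (\<Union>y\<in>?S. neighbors E y))"
    proof (cases "x = v")
      case False
      with x obtain y where "y \<in> set_pmf (K x)" "hit v n y \<noteq> 0"
        unfolding mem_Collect_eq hit_Suc[OF False] by (metis (no_types, lifting) mult_zero_right sum.neutral)
      then show ?thesis
        by (auto simp: set_pmf_K neighbors_def insert_commute split: if_splits)
    qed simp
  qed
  moreover have "(\<Union>y\<in>?S. neighbors E y) \<subseteq> V"
    using edge_vertices by (auto simp: neighbors_def)
  moreover have "finite (insert v (?S \<union> (\<Union>y\<in>?S. neighbors E y)))"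
    using Suc finite_neighbors by auto
  moreover have "?S \<subseteq> insert v V" using Suc by blast
  ultimately show ?case by (blast intro: finite_subset)
qed

lemma reversible_sum:
  "total_conductance x * (\<Sum>y\<in>set_pmf (K x). pmf (K x) y * f y) = (\<Sum>y\<in>neighbors E x. conductance x y * f y)"
proof (cases "neighbors E x = {}")
  case False
  then show ?thesis
    using total_conductance_pos[OF False] by (simp add: set_pmf_K pmf_K sum_distrib_left)
qed (simp add: total_conductance_def)

lemma sum_conductance_diff:
  "(\<Sum>y\<in>neighbors E x. conductance x y * (f x - f y)) =
    total_conductance x * (f x - (\<Sum>y\<in>set_pmf (K x). pmf (K x) y * f y))"
  by (simp add: right_diff_distrib sum_subtractf reversible_sum sum_distrib_right[symmetric] total_conductance_def[symmetric])

text \<open>Off \<open>v\<close> the potential \<open>hit v n\<close> is subharmonic, because applying the kernel to it gives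
\<open>hit v (Suc n)\<close>, which is larger; hence in the summation by parts only the term at \<open>v\<close> is positive,
and it is the probability of not returning within \<open>Suc n\<close> steps.\<close>

lemma dirichlet_hit_le: "dirichlet E R (hit v n) \<le> 2 * total_conductance v * avoid_prob K v (Suc n) v"
proof -
  let ?h = "hit v n" and ?S = "insert v {x. hit v n x \<noteq> 0}"
  define \<theta> where "\<theta> x y = conductance x y * (?h x - ?h y)" for x y
  have S: "finite ?S" "\<And>x. x \<notin> ?S \<Longrightarrow> ?h x = 0"
    using finite_hit_support by auto
  have div: "(\<Sum>y\<in>neighbors E x. \<theta> x y) = total_conductance x * (if x = v then avoid_prob K v (Suc n) v else ?h x - hit v (Suc n) x)" for x
    unfolding \<theta>_def sum_conductance_diff using avoid_Suc_hit[of v n v] hit_Suc[of x v n]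
    by (auto simp: hit_def[of v n v])
  have "dirichlet E R ?h = (\<Sum>(x, y)\<in>arcs_at E ?S. (?h x - ?h y)\<^sup>2 / R {x, y})"
    by (rule dirichlet_arcs_at[OF S])
  also have "\<dots> = (\<Sum>(x, y)\<in>arcs_at E ?S. \<theta> x y * (?h x - ?h y))"
    by (intro sum.cong) (auto simp: \<theta>_def conductance_def arcs_at_def power2_eq_square divide_inverse)
  also have "\<dots> = 2 * (\<Sum>x\<in>?S. ?h x * (\<Sum>y\<in>neighbors E x. \<theta> x y))"
  proof (rule summation_by_parts[OF S])
    show "\<theta> y x = - \<theta> x y" for x y
      unfolding \<theta>_def conductance_sym[of y x] by (simp add: algebra_simps)
  qed
  also have "(\<Sum>x\<in>?S. ?h x * (\<Sum>y\<in>neighbors E x. \<theta> x y)) \<le> (\<Sum>x\<in>?S. if x = v then total_conductance v * avoid_prob K v (Suc n) v else 0)"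
  proof (intro sum_mono)
    fix x
    have "?h x * (total_conductance x * (?h x - hit v (Suc n) x)) \<le> 0"
      using hit_bounds[of v n x] total_conductance_nonneg[of x] hit_mono[of v n x]
      by (intro mult_nonneg_nonpos) auto
    then show "?h x * (\<Sum>y\<in>neighbors E x. \<theta> x y) \<le> (if x = v then total_conductance v * avoid_prob K v (Suc n) v else 0)"
      unfolding div by (auto simp: hit_def[of v n v])
  qed
  also have "\<dots> = total_conductance v * avoid_prob K v (Suc n) v"
    by (subst sum.delta[OF S(1)]) simp
  finally show ?thesis by simp
qed


section \<open>Capacity, flows and transience\<close>

text \<open>For a recurrent \<open>v\<close> the bound on the energy of \<open>hit v n\<close> tends to zero.  Rounding the potential down
to multiples of \<open>1 / Suc k\<close> makes it rational without enlarging the support, and as only finitely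
many edges are involved the energies converge as \<open>k\<close> grows.\<close>

lemma recurrent_imp_small_dirichlet:
  assumes v: "v \<in> V" and rec: "\<not> transient_state K v" and e: "0 < \<epsilon>"
  shows "\<exists>f\<in>test_functions V v. dirichlet E R f < \<epsilon>"
proof -
  define d where "d = \<epsilon> / (2 * total_conductance v + 1)"
  have d: "0 < d" using e total_conductance_nonneg[of v] by (auto simp: d_def intro!: divide_pos_pos add_nonneg_pos)
  obtain n where n: "avoid_prob K v n v < d"
    using rec d unfolding transient_state_iff_avoid[of K, OF finite_K] by (meson not_le)
  have "dirichlet E R (hit v n) \<le> 2 * total_conductance v * avoid_prob K v (Suc n) v"
    by (rule dirichlet_hit_le)
  also have "\<dots> \<le> 2 * total_conductance v * d"
    using n avoid_Suc_le[where K=K and v=v and n=n and x=v, OF finite_K] total_conductance_nonneg[of v]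
    by (intro mult_left_mono) auto
  also have "\<dots> < \<epsilon>"
    using e total_conductance_nonneg[of v] by (simp add: d_def field_simps)
  finally have small: "dirichlet E R (hit v n) < \<epsilon>" .
  define S where "S = {x. hit v n x \<noteq> 0}"
  have S: "finite S" "S \<subseteq> V"
    using finite_hit_support[of v n] v by (auto simp: S_def)
  define g where "g k x = real_of_int \<lfloor>real (Suc k) * hit v n x\<rfloor> / real (Suc k)" for k x
  have g0: "g k x = 0" if "x \<notin> S" for k x
    using that by (simp add: g_def S_def)
  have lim: "(\<lambda>k. g k x) \<longlonglongrightarrow> hit v n x" for x
  proof (rule tendsto_sandwich)
    show "\<forall>\<^sub>F k in sequentially. hit v n x - inverse (real (Suc k)) \<le> g k x"
    proof (rule always_eventually, rule allI)
      fix k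
      have "real (Suc k) * hit v n x - 1 \<le> real_of_int \<lfloor>real (Suc k) * hit v n x\<rfloor>"
        by linarith
      then have "(real (Suc k) * hit v n x - 1) / real (Suc k) \<le> g k x"
        unfolding g_def by (intro divide_right_mono) auto
      then show "hit v n x - inverse (real (Suc k)) \<le> g k x"
        by (simp add: diff_divide_distrib inverse_eq_divide)
    qed
    show "\<forall>\<^sub>F k in sequentially. g k x \<le> hit v n x"
      by (intro always_eventually allI) (simp add: g_def divide_le_eq mult.commute)
    show "(\<lambda>k. hit v n x - inverse (real (Suc k))) \<longlonglongrightarrow> hit v n x"
      using tendsto_diff[OF tendsto_const LIMSEQ_inverse_real_of_nat] by simp
  qed simp
  have "(\<lambda>k. dirichlet E R (g k)) \<longlonglongrightarrow> dirichlet E R (hit v n)"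
  proof -
    have "(\<lambda>k. \<Sum>(x, y)\<in>arcs_at E S. (g k x - g k y)\<^sup>2 / R {x, y}) \<longlonglongrightarrow>
      (\<Sum>(x, y)\<in>arcs_at E S. (hit v n x - hit v n y)\<^sup>2 / R {x, y})"
      unfolding case_prod_beta using R_pos
      by (intro tendsto_sum tendsto_divide tendsto_power tendsto_diff lim tendsto_const)
        (auto simp: arcs_at_def dest!: R_pos)
    then show ?thesis
      using dirichlet_arcs_at[OF S(1), of "g _", OF g0] dirichlet_arcs_at[OF S(1), of "hit v n"]
      by (simp add: S_def)
  qed
  from order_tendstoD(2)[OF this small] obtain k where k: "dirichlet E R (g k) < \<epsilon>"
    by (auto simp: eventually_sequentially)
  have "g k \<in> test_functions V v"
  proof -
    have "{x. g k x \<noteq> 0} \<subseteq> S" using g0 by auto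
    moreover have "g k v = 1"
      unfolding g_def by (simp add: hit_def)
    moreover have "range (g k) \<subseteq> \<rat>"
      by (auto simp: g_def intro!: Rats_divide)
    ultimately show ?thesis
      using S by (auto simp: test_functions_def intro: finite_subset)
  qed
  with k show ?thesis by blast
qed

lemma positive_capacity_imp_transient:
  assumes "v \<in> V" "positive_capacity V E R v"
  shows "transient_state K v"
  using assms recurrent_imp_small_dirichlet[OF assms(1)] by (meson positive_capacity_def not_le)

text \<open>The duality between flows and potentials: pairing a unit flow from \<open>v\<close> with the gradient of a test
function gives a fixed number, so by Cauchy-Schwarz the two energies cannot both be small.\<close>

lemma flow_imp_positive_capacity:
  assumes v: "v \<in> V" and flow: "finite_energy_flow V E R v"
  shows "positive_capacity V E R v"
proof -
  obtain F where F: "unit_flow V E v F" and en: "energy E R F < \<infinity>"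
    using flow by (auto simp: finite_energy_flow_def)
  define I where "I = (\<integral>\<^sup>+ (x, y). ennreal ((F x y)\<^sup>2 * R {x, y}) \<partial>count_space {(x, y). {x, y} \<in> E})"
  have "I < \<infinity>"
    using en unfolding energy_def I_def[symmetric] by (simp add: ennreal_divide_eq_top_iff less_top[symmetric])
  \<comment> \<open>the summand \<open>1\<close> makes \<open>W\<close> positive\<close>
  define W where "W = enn2real I + 1"
  have W: "0 < W" "I \<le> ennreal W"
    using \<open>I < \<infinity>\<close> by (auto simp: W_def less_top intro!: add_nonneg_pos)
  have fin_le: "(\<Sum>(x, y)\<in>T. (F x y)\<^sup>2 * R {x, y}) \<le> W" if T: "finite T" "T \<subseteq> {(x, y). {x, y} \<in> E}" for T
  proof -
    have "ennreal (\<Sum>(x, y)\<in>T. (F x y)\<^sup>2 * R {x, y}) = (\<Sum>p\<in>T. ennreal (case p of (x, y) \<Rightarrow> (F x y)\<^sup>2 * R {x, y}))"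
    proof (intro sum_ennreal[symmetric])
      fix p assume "p \<in> T"
      with T obtain x y where "p = (x, y)" "{x, y} \<in> E" by auto
      then show "0 \<le> (case p of (x, y) \<Rightarrow> (F x y)\<^sup>2 * R {x, y})"
        using R_pos[of "{x, y}"] by simp
    qed
    also have "\<dots> = (\<integral>\<^sup>+ (x, y). ennreal ((F x y)\<^sup>2 * R {x, y}) \<partial>count_space T)"
      using T by (simp add: nn_integral_count_space_finite case_prod_beta)
    also have "\<dots> \<le> I"
      unfolding I_def nn_integral_count_space_indicator[of T] nn_integral_count_space_indicator[of "{(x, y). {x, y} \<in> E}"]
      using T by (subst (1 2) nn_integral_count_space_indicator) (auto intro!: nn_integral_mono split: split_indicator)
    also note W(2)
    finally show ?thesis using W(1) by (simp add: ennreal_le_iff)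
  qed
  have anti: "F y x = - F x y" and div: "x \<in> V \<Longrightarrow> (\<Sum>y\<in>neighbors E x. F x y) = (if x = v then 1 else 0)" for x y
    using F unfolding unit_flow_def by blast+
  have "4 / W \<le> dirichlet E R f" if f: "f \<in> test_functions V v" for f
  proof -
    define S where "S = {x. f x \<noteq> 0}"
    have S: "finite S" "\<And>x. x \<notin> S \<Longrightarrow> f x = 0" "S \<subseteq> V" and fv: "f v = 1"
      using f by (auto simp: S_def test_functions_def)
    let ?T = "arcs_at E S"
    have T: "finite ?T" "?T \<subseteq> {(x, y). {x, y} \<in> E}"
      using finite_arcs_at[OF S(1)] by (auto simp: arcs_at_def)
    have "(\<Sum>(x, y)\<in>?T. F x y * (f x - f y)) = 2 * (\<Sum>x\<in>S. f x * (\<Sum>y\<in>neighbors E x. F x y))"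
      by (rule summation_by_parts[OF S(1,2) anti])
    also have "(\<Sum>x\<in>S. f x * (\<Sum>y\<in>neighbors E x. F x y)) = (\<Sum>x\<in>S. if x = v then 1 else 0)"
      using S(3) div fv by (intro sum.cong) auto
    also have "\<dots> = 1"
      using fv by (subst sum.delta[OF S(1)]) (simp add: S_def)
    finally have two: "(\<Sum>(x, y)\<in>?T. F x y * (f x - f y)) = 2" by simp
    have "(\<Sum>(x, y)\<in>?T. F x y * (f x - f y)) =
        (\<Sum>p\<in>?T. (F (fst p) (snd p) * sqrt (R {fst p, snd p})) * ((f (fst p) - f (snd p)) / sqrt (R {fst p, snd p})))"
      by (intro sum.cong) (auto simp: arcs_at_def dest!: R_pos)
    also have "\<dots>\<^sup>2 \<le> (\<Sum>p\<in>?T. (F (fst p) (snd p) * sqrt (R {fst p, snd p}))\<^sup>2) *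
        (\<Sum>p\<in>?T. ((f (fst p) - f (snd p)) / sqrt (R {fst p, snd p}))\<^sup>2)"
      by (rule Cauchy_Schwarz_ineq_sum)
    also have "(\<Sum>p\<in>?T. (F (fst p) (snd p) * sqrt (R {fst p, snd p}))\<^sup>2) = (\<Sum>(x, y)\<in>?T. (F x y)\<^sup>2 * R {x, y})"
      by (intro sum.cong) (auto simp: arcs_at_def power_mult_distrib dest!: R_pos)
    also have "(\<Sum>p\<in>?T. ((f (fst p) - f (snd p)) / sqrt (R {fst p, snd p}))\<^sup>2) = dirichlet E R f"
      by (subst dirichlet_arcs_at[where f=f and R=R, OF S(1,2)], assumption, intro sum.cong) (auto simp: arcs_at_def power_divide dest!: R_pos)
    finally have "4 \<le> (\<Sum>(x, y)\<in>?T. (F x y)\<^sup>2 * R {x, y}) * dirichlet E R f"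
      unfolding two by simp
    also have "\<dots> \<le> W * dirichlet E R f"
      by (intro mult_right_mono fin_le T dirichlet_nonneg)
    finally show ?thesis
      using W by (simp add: divide_le_eq mult.commute)
  qed
  moreover have "0 < 4 / W" using W by simp
  ultimately show ?thesis unfolding positive_capacity_def by blast
qed

text \<open>The limit \<open>h\<close> of the potentials is the probability of ever visiting \<open>v\<close>.  It is harmonic off \<open>v\<close>, and
at \<open>v\<close> its divergence is the conductance times the escape probability, which is positive; so its
normalized gradient is a unit flow.  The energies of \<open>hit v n\<close> are bounded, and Fatou's lemma
passes the bound to \<open>h\<close>.\<close>

lemma transient_imp_flow:
  assumes v: "v \<in> V" and tr: "transient_state K v"
  shows "finite_energy_flow V E R v"
proof -
  obtain \<epsilon> where e: "\<epsilon> > 0" "\<And>n. \<epsilon> \<le> avoid_prob K v n v"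
    using tr unfolding transient_state_iff_avoid[of K, OF finite_K] by blast
  have "neighbors E v \<noteq> {}"
  proof
    assume "neighbors E v = {}"
    then have "avoid_prob K v (Suc 0) v = 0" by (simp add: K_isolated)
    with e(1) e(2)[of "Suc 0"] show False by simp
  qed
  then have tv: "0 < total_conductance v" by (rule total_conductance_pos)
  define h where "h x = (SUP n. hit v n x)" for x
  have lim: "(\<lambda>n. hit v n x) \<longlonglongrightarrow> h x" for x
    unfolding h_def using hit_bounds hit_mono
    by (intro LIMSEQ_incseq_SUP incseq_SucI bdd_aboveI2[where M=1]) auto
  define a where "a = 1 - (\<Sum>y\<in>set_pmf (K v). pmf (K v) y * h y)"
  have sum_lim: "(\<lambda>n. \<Sum>y\<in>set_pmf (K x). pmf (K x) y * hit v n y) \<longlonglongrightarrow> (\<Sum>y\<in>set_pmf (K x). pmf (K x) y * h y)" for x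
    by (intro tendsto_intros lim)
  have "(\<lambda>n. avoid_prob K v (Suc n) v) \<longlonglongrightarrow> a"
    unfolding a_def avoid_Suc_hit by (intro tendsto_intros sum_lim)
  then have "\<epsilon> \<le> a"
    by (rule LIMSEQ_le_const) (use e(2) in blast)
  then have a: "0 < a" using e by simp
  have hv: "h v = 1" by (simp add: h_def hit_def)
  have harm: "h x = (\<Sum>y\<in>set_pmf (K x). pmf (K x) y * h y)" if "x \<noteq> v" for x
    using LIMSEQ_unique[OF LIMSEQ_Suc[OF lim[of x], unfolded hit_Suc[OF that]] sum_lim] .
  define b where "b = total_conductance v * a"
  have b: "0 < b" using tv a by (simp add: b_def)
  define F where "F x y = conductance x y * (h x - h y) / b" for x y
  have div: "(\<Sum>y\<in>neighbors E x. F x y) = (if x = v then 1 else 0)" for x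
  proof -
    have "(\<Sum>y\<in>neighbors E x. F x y) = total_conductance x * (h x - (\<Sum>y\<in>set_pmf (K x). pmf (K x) y * h y)) / b"
      unfolding F_def sum_divide_distrib[symmetric] sum_conductance_diff ..
    also have "\<dots> = (if x = v then 1 else 0)"
    proof (cases "x = v")
      case True
      have "total_conductance v * (h v - (\<Sum>y\<in>set_pmf (K v). pmf (K v) y * h y)) = b"
        by (simp only: b_def a_def hv)
      then show ?thesis using b True by simp
    next
      case False
      show ?thesis using harm[OF False] False by simp
    qed
    finally show ?thesis .
  qed
  have flow: "unit_flow V E v F"
    unfolding unit_flow_def using div
    by (auto simp: F_def conductance_def insert_commute algebra_simps diff_divide_distrib)
  let ?A = "{(x, y). {x, y} \<in> E}"
  define G where "G n p = ennreal ((hit v n (fst p) - hit v n (snd p))\<^sup>2 / R {fst p, snd p})" for n p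
  have "(\<integral>\<^sup>+ (x, y). ennreal ((F x y)\<^sup>2 * R {x, y}) \<partial>count_space ?A) =
      (\<integral>\<^sup>+ p. liminf (\<lambda>n. G n p) * ennreal (1 / b\<^sup>2) \<partial>count_space ?A)"
  proof (rule nn_integral_cong)
    fix p assume "p \<in> space (count_space ?A)"
    then obtain x y where p: "p = (x, y)" and xy: "{x, y} \<in> E" by auto
    have "(\<lambda>n. G n p) \<longlonglongrightarrow> ennreal ((h x - h y)\<^sup>2 / R {x, y})"
      unfolding G_def p fst_conv snd_conv using R_pos[OF xy]
      by (intro tendsto_ennrealI tendsto_intros lim) auto
    then have "liminf (\<lambda>n. G n p) = ennreal ((h x - h y)\<^sup>2 / R {x, y})"
      by (intro lim_imp_Liminf) auto
    moreover have "(F x y)\<^sup>2 * R {x, y} = ((h x - h y)\<^sup>2 / R {x, y}) * (1 / b\<^sup>2)"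
      using R_pos[OF xy] b xy by (simp add: F_def conductance_def field_simps power2_eq_square)
    ultimately show "(case p of (x, y) \<Rightarrow> ennreal ((F x y)\<^sup>2 * R {x, y})) = liminf (\<lambda>n. G n p) * ennreal (1 / b\<^sup>2)"
      using R_pos[OF xy] by (simp add: p ennreal_mult[symmetric])
  qed
  also have "\<dots> = (\<integral>\<^sup>+ p. liminf (\<lambda>n. G n p) \<partial>count_space ?A) * ennreal (1 / b\<^sup>2)"
    by (rule nn_integral_multc) simp
  also have "(\<integral>\<^sup>+ p. liminf (\<lambda>n. G n p) \<partial>count_space ?A) \<le> liminf (\<lambda>n. \<integral>\<^sup>+ p. G n p \<partial>count_space ?A)"
    by (rule nn_integral_liminf) simp
  also have "\<dots> \<le> ennreal (2 * total_conductance v)"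
  proof (rule Liminf_le[OF sequentially_bot always_eventually], rule allI)
    fix n
    let ?T = "{(x, y). {x, y} \<in> E \<and> hit v n x \<noteq> hit v n y}"
    have "finite ?T"
    proof (rule finite_subset)
      show "?T \<subseteq> arcs_at E {x. hit v n x \<noteq> 0}" by (auto simp: arcs_at_def)
    qed (use finite_arcs_at finite_hit_support in blast)
    then have "(\<integral>\<^sup>+ p. G n p \<partial>count_space ?A) = (\<Sum>p\<in>?T. G n p)"
      by (intro nn_integral_count_space') (auto simp: G_def)
    also have "\<dots> = ennreal (dirichlet E R (hit v n))"
      unfolding G_def dirichlet_def case_prod_beta using R_pos
      by (intro sum_ennreal) (auto intro!: divide_nonneg_pos)
    also have "\<dots> \<le> ennreal (2 * total_conductance v)"
    proof (rule ennreal_leI)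
      have "avoid_prob K v (Suc n) v \<le> 1"
        using avoid_bounds[where K=K and v=v and n="Suc n" and x=v, OF finite_K] by blast
      then show "dirichlet E R (hit v n) \<le> 2 * total_conductance v"
        using dirichlet_hit_le[of v n] tv by (meson mult_left_le order_trans mult_nonneg_nonneg total_conductance_nonneg zero_le_numeral)
    qed
    finally show "(\<integral>\<^sup>+ p. G n p \<partial>count_space ?A) \<le> ennreal (2 * total_conductance v)" .
  qed
  finally have "energy E R F \<le> ennreal (2 * total_conductance v) * ennreal (1 / b\<^sup>2) / 2"
    unfolding energy_def by (intro divide_right_mono_ennreal) (simp add: mult_right_mono)
  also have "\<dots> < \<infinity>"
    by (simp add: ennreal_mult[symmetric] tv less_imp_le ennreal_divide_eq_top_iff less_top[symmetric])
  finally show ?thesis using flow by (auto simp: finite_energy_flow_def)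
qed

text \<open>Prepending the edge from \<open>w\<close> to \<open>v\<close> moves the source of a flow at finite cost.\<close>

lemma flow_step:
  assumes wv: "{w, v} \<in> E" and flow: "finite_energy_flow V E R v"
  shows "finite_energy_flow V E R w"
proof -
  obtain F where F: "unit_flow V E v F" and en: "energy E R F < \<infinity>"
    using flow by (auto simp: finite_energy_flow_def)
  have neq: "w \<noteq> v" and nb: "v \<in> neighbors E w" "w \<in> neighbors E v"
    using wv edge_vertices[OF wv] by (auto simp: neighbors_def insert_commute)
  define D :: "'v \<Rightarrow> 'v \<Rightarrow> real" where "D x y = (if x = w \<and> y = v then 1 else if x = v \<and> y = w then - 1 else 0)" for x y
  define G where "G x y = F x y + D x y" for x y
  have divD: "(\<Sum>y\<in>neighbors E x. D x y) = (if x = w then 1 else if x = v then - 1 else 0)" for x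
  proof -
    have "(\<Sum>y\<in>neighbors E w. D w y) = (\<Sum>y\<in>neighbors E w. if y = v then 1 else 0)"
      using neq by (intro sum.cong) (auto simp: D_def)
    moreover have "(\<Sum>y\<in>neighbors E v. D v y) = (\<Sum>y\<in>neighbors E v. if y = w then - 1 else 0)"
      using neq by (intro sum.cong) (auto simp: D_def)
    moreover have "D x y = 0" if "x \<noteq> w" "x \<noteq> v" for y
      using that by (simp add: D_def)
    ultimately show ?thesis
      using nb finite_neighbors by (auto simp: sum.delta)
  qed
  have G: "unit_flow V E w G"
    unfolding unit_flow_def
  proof (intro conjI allI impI ballI)
    have vw: "{v, w} \<in> E" using wv by (simp add: insert_commute)
    show "G x y = 0" if "{x, y} \<notin> E" for x y
    proof -
      have "F x y = 0" using F that unfolding unit_flow_def by blast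
      then show ?thesis using that wv vw by (auto simp: G_def D_def)
    qed
    show "G y x = - G x y" for x y
    proof -
      have "F y x = - F x y" using F unfolding unit_flow_def by blast
      then show ?thesis using neq by (simp add: G_def D_def)
    qed
    show "(\<Sum>y\<in>neighbors E x. G x y) = (if x = w then 1 else 0)" if "x \<in> V" for x
    proof -
      have "(\<Sum>y\<in>neighbors E x. F x y) = (if x = v then 1 else 0)"
        using F that unfolding unit_flow_def by blast
      then show ?thesis using neq by (simp add: G_def sum.distrib divD)
    qed
  qed
  let ?A = "{(x, y). {x, y} \<in> E}"
  have "(\<integral>\<^sup>+ (x, y). ennreal ((G x y)\<^sup>2 * R {x, y}) \<partial>count_space ?A) \<le>
      (\<integral>\<^sup>+ p. 2 * (case p of (x, y) \<Rightarrow> ennreal ((F x y)\<^sup>2 * R {x, y})) + 2 * (case p of (x, y) \<Rightarrow> ennreal ((D x y)\<^sup>2 * R {x, y})) \<partial>count_space ?A)"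
  proof (rule nn_integral_mono)
    fix p assume "p \<in> space (count_space ?A)"
    then obtain x y where p: "p = (x, y)" and xy: "{x, y} \<in> E" by auto
    have "(G x y)\<^sup>2 \<le> 2 * (F x y)\<^sup>2 + 2 * (D x y)\<^sup>2"
      unfolding G_def using sum_squares_bound[of "F x y" "D x y"] by (simp add: power2_sum)
    then have "(G x y)\<^sup>2 * R {x, y} \<le> 2 * ((F x y)\<^sup>2 * R {x, y}) + 2 * ((D x y)\<^sup>2 * R {x, y})"
      using mult_right_mono[of _ _ "R {x, y}"] R_pos[OF xy] by (fastforce simp: algebra_simps)
    then have "ennreal ((G x y)\<^sup>2 * R {x, y}) \<le> ennreal (2 * ((F x y)\<^sup>2 * R {x, y}) + 2 * ((D x y)\<^sup>2 * R {x, y}))"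
      by (rule ennreal_leI)
    then show "(case p of (x, y) \<Rightarrow> ennreal ((G x y)\<^sup>2 * R {x, y})) \<le>
       2 * (case p of (x, y) \<Rightarrow> ennreal ((F x y)\<^sup>2 * R {x, y})) + 2 * (case p of (x, y) \<Rightarrow> ennreal ((D x y)\<^sup>2 * R {x, y}))"
      using R_pos[OF xy] by (simp add: p ennreal_plus ennreal_mult')
  qed
  also have "\<dots> = 2 * (\<integral>\<^sup>+ (x, y). ennreal ((F x y)\<^sup>2 * R {x, y}) \<partial>count_space ?A) +
      2 * (\<integral>\<^sup>+ (x, y). ennreal ((D x y)\<^sup>2 * R {x, y}) \<partial>count_space ?A)"
    by (subst nn_integral_add) (simp_all add: nn_integral_cmult)
  also have "(\<integral>\<^sup>+ (x, y). ennreal ((D x y)\<^sup>2 * R {x, y}) \<partial>count_space ?A) = (\<Sum>p\<in>{(w, v), (v, w)}. case p of (x, y) \<Rightarrow> ennreal ((D x y)\<^sup>2 * R {x, y}))"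
    using wv by (intro nn_integral_count_space') (auto simp: D_def insert_commute split: if_splits)
  also have "2 * (\<integral>\<^sup>+ (x, y). ennreal ((F x y)\<^sup>2 * R {x, y}) \<partial>count_space ?A) + 2 * \<dots> < \<infinity>"
    using en neq unfolding energy_def
    by (simp add: ennreal_divide_eq_top_iff less_top[symmetric] ennreal_mult_eq_top_iff)
  finally have "energy E R G < \<infinity>"
    unfolding energy_def by (simp add: ennreal_divide_eq_top_iff less_top[symmetric])
  with G show ?thesis by (auto simp: finite_energy_flow_def)
qed

lemma flow_joined:
  assumes "joined E w v" "finite_energy_flow V E R v"
  shows "finite_energy_flow V E R w"
  using assms(1) unfolding joined_def
  by (induction rule: converse_rtrancl_induct) (auto intro: flow_step assms(2))

lemma transient_state_iff_flow:
  "v \<in> V \<Longrightarrow> transient_state K v \<longleftrightarrow> finite_energy_flow V E R v"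
  using positive_capacity_imp_transient flow_imp_positive_capacity transient_imp_flow by blast

lemma positive_capacity_iff_flow:
  "v \<in> V \<Longrightarrow> positive_capacity V E R v \<longleftrightarrow> finite_energy_flow V E R v"
  using positive_capacity_imp_transient flow_imp_positive_capacity transient_imp_flow by blast

text \<open>Flows can be moved along paths, so on a connected graph the behaviour at one vertex decides.\<close>

lemma network_transient_iff_capacity:
  assumes conn: "connected_graph V E" and v: "v \<in> V"
  shows "network_transient V E R \<longleftrightarrow> positive_capacity V E R v"
  using conn v flow_joined unfolding network_transient_def transient_chain_def connected_graph_def
  by (metis transient_state_iff_flow positive_capacity_iff_flow)

lemma network_transient_iff_resistance:
  assumes conn: "connected_graph V E"
  shows "network_transient V E R \<longleftrightarrow> finite_net_resistance V E R"
  using conn flow_joined unfolding network_transient_def transient_chain_def connected_graph_def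
    finite_net_resistance_def net_resistance_finite_iff
  by (metis transient_state_iff_flow ex_in_conv)

end

section \<open>Subgraphs and clusters\<close>

lemma dirichlet_cong:
  "(\<And>e. e \<in> E \<Longrightarrow> R e = R' e) \<Longrightarrow> dirichlet E R f = dirichlet E R' f"
  unfolding dirichlet_def by (intro sum.cong) auto

lemma positive_capacity_cong:
  assumes "\<And>e. e \<in> E \<Longrightarrow> R e = R' e"
  shows "positive_capacity V E R v = positive_capacity V E R' v"
  unfolding positive_capacity_def using dirichlet_cong[of E R R', OF assms] by simp

lemma positive_capacity_mono:
  assumes a: "0 < a" and le: "\<And>f. f \<in> test_functions V v \<Longrightarrow> a * dirichlet E R f \<le> dirichlet E' R' f"
    and pos: "positive_capacity V E R v"
  shows "positive_capacity V E' R' v"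
proof -
  obtain \<epsilon> where e: "\<epsilon> > 0" "\<And>f. f \<in> test_functions V v \<Longrightarrow> \<epsilon> \<le> dirichlet E R f"
    using pos by (auto simp: positive_capacity_def)
  have "a * \<epsilon> \<le> dirichlet E' R' f" if "f \<in> test_functions V v" for f
    using mult_left_mono[OF e(2)[OF that], of a] le[OF that] a by linarith
  moreover have "0 < a * \<epsilon>" using a e(1) by simp
  ultimately show ?thesis unfolding positive_capacity_def by blast
qed

text \<open>A countable form of the definition, for measurability.\<close>

lemma positive_capacity_iff_nat:
  "positive_capacity V E R v \<longleftrightarrow> (\<exists>m. \<forall>f\<in>test_functions V v. inverse (real (Suc m)) \<le> dirichlet E R f)"
proof
  assume "positive_capacity V E R v"
  then obtain \<epsilon> where e: "\<epsilon> > 0" "\<And>f. f \<in> test_functions V v \<Longrightarrow> \<epsilon> \<le> dirichlet E R f"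
    by (auto simp: positive_capacity_def)
  then obtain m where "inverse (real (Suc m)) < \<epsilon>" using reals_Archimedean by blast
  then show "\<exists>m. \<forall>f\<in>test_functions V v. inverse (real (Suc m)) \<le> dirichlet E R f"
    using e(2) by (intro exI[of _ m] ballI) (meson less_le_trans less_imp_le)
next
  assume "\<exists>m. \<forall>f\<in>test_functions V v. inverse (real (Suc m)) \<le> dirichlet E R f"
  then obtain m where "\<forall>f\<in>test_functions V v. inverse (real (Suc m)) \<le> dirichlet E R f" ..
  moreover have "0 < inverse (real (Suc m))" by simp
  ultimately show "positive_capacity V E R v" unfolding positive_capacity_def by blast
qed

lemma countable_test_functions:
  assumes "countable V"
  shows "countable (test_functions V v)"
proof (rule countable_subset)
  show "test_functions V v \<subseteq> (\<Union>S\<in>{S. finite S \<and> S \<subseteq> V}. (\<lambda>g x. if x \<in> S then g x else 0) ` PiE S (\<lambda>_. \<rat>))"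
  proof
    fix f :: "'a \<Rightarrow> real" assume f: "f \<in> test_functions V v"
    let ?S = "{x. f x \<noteq> 0}"
    have "f = (\<lambda>x. if x \<in> ?S then restrict f ?S x else 0)" by (auto simp: fun_eq_iff)
    moreover have "restrict f ?S \<in> PiE ?S (\<lambda>_. \<rat>)"
      using f unfolding test_functions_def by auto
    ultimately have "f \<in> (\<lambda>g x. if x \<in> ?S then g x else 0) ` PiE ?S (\<lambda>_. \<rat>)" by (rule image_eqI)
    moreover have "?S \<in> {S. finite S \<and> S \<subseteq> V}" using f by (auto simp: test_functions_def)
    ultimately show "f \<in> (\<Union>S\<in>{S. finite S \<and> S \<subseteq> V}. (\<lambda>g x. if x \<in> S then g x else 0) ` PiE S (\<lambda>_. \<rat>))"
      by (intro UN_I)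
  qed
  show "countable (\<Union>S\<in>{S. finite S \<and> S \<subseteq> V}. (\<lambda>g x. if x \<in> S then g x else 0) ` PiE S (\<lambda>_. \<rat> :: real set))"
  proof (rule countable_UN)
    show "countable {S. finite S \<and> S \<subseteq> V}" by (rule countable_Collect_finite_subset[OF assms])
    show "countable ((\<lambda>g x. if x \<in> S then g x else 0) ` PiE S (\<lambda>_. \<rat> :: real set))"
      if "S \<in> {S. finite S \<and> S \<subseteq> V}" for S
    proof (rule countable_image, rule countable_PiE)
      show "finite S" using that by simp
      show "countable (\<rat> :: real set)" by (rule countable_rat)
    qed
  qed
qed

lemma unit_test_function: "v \<in> V \<Longrightarrow> (\<lambda>x. if x = v then 1 else 0) \<in> test_functions V v"
  unfolding test_functions_def
  by (auto intro: finite_subset[of _ "{v}"] split: if_splits)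

context lf_graph
begin

lemma finite_difference_arcs:
  assumes "finite {x. f x \<noteq> (0 :: real)}"
  shows "finite {(x, y). {x, y} \<in> E \<and> f x \<noteq> f y}"
proof (rule finite_subset)
  show "{(x, y). {x, y} \<in> E \<and> f x \<noteq> f y} \<subseteq> arcs_at E {x. f x \<noteq> 0}" by (auto simp: arcs_at_def)
qed (rule finite_arcs_at[OF assms])

lemma finite_test_arcs:
  "f \<in> test_functions U v \<Longrightarrow> finite {(x, y). {x, y} \<in> E \<and> f x \<noteq> f y}"
  by (intro finite_difference_arcs) (simp add: test_functions_def)

lemma subgraph:
  assumes "F \<subseteq> E"
  shows "lf_graph V F"
proof
  show "simple_graph V F" using simple assms by (auto simp: simple_graph_def)
  have "neighbors F x \<subseteq> neighbors E x" for x using assms by (auto simp: neighbors_def)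
  then show "locally_finite V F" by (auto simp: locally_finite_def intro: finite_subset[OF _ finite_neighbors])
qed

text \<open>Rayleigh monotonicity: adding edges and lowering resistances, up to a constant factor, can only
raise the capacity.\<close>

lemma positive_capacity_subgraph:
  assumes F: "F \<subseteq> E" and c: "\<And>e. e \<in> F \<Longrightarrow> R e \<le> c * R' e" "0 < c"
    and pos: "\<And>e. e \<in> E \<Longrightarrow> 0 < R e" "\<And>e. e \<in> F \<Longrightarrow> 0 < R' e"
    and cap: "positive_capacity V F R' v"
  shows "positive_capacity V E R v"
proof (rule positive_capacity_mono[OF _ _ cap])
  show "0 < 1 / c" using c by simp
  fix f assume f: "f \<in> test_functions V v"
  have "1 / c * dirichlet F R' f \<le> dirichlet F R f"
    unfolding dirichlet_def sum_distrib_left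
  proof (rule sum_mono)
    fix p assume "p \<in> {(x, y). {x, y} \<in> F \<and> f x \<noteq> f y}"
    then obtain x y where p: "p = (x, y)" and xy: "{x, y} \<in> F" by auto
    have "(f x - f y)\<^sup>2 / (c * R' {x, y}) \<le> (f x - f y)\<^sup>2 / R {x, y}"
      using c(1)[OF xy] pos(1)[of "{x, y}"] xy F by (intro divide_left_mono) (auto intro!: mult_pos_pos c(2) pos(2))
    then show "1 / c * (case p of (x, y) \<Rightarrow> (f x - f y)\<^sup>2 / R' {x, y}) \<le> (case p of (x, y) \<Rightarrow> (f x - f y)\<^sup>2 / R {x, y})"
      by (simp add: p)
  qed
  also have "\<dots> \<le> dirichlet E R f"
    unfolding dirichlet_def
  proof (rule sum_mono2[OF finite_test_arcs[OF f]])
    fix p assume "p \<in> {(x, y). {x, y} \<in> E \<and> f x \<noteq> f y} - {(x, y). {x, y} \<in> F \<and> f x \<noteq> f y}"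
    then obtain x y where p: "p = (x, y)" and xy: "{x, y} \<in> E" by auto
    show "0 \<le> (case p of (x, y) \<Rightarrow> (f x - f y)\<^sup>2 / R {x, y})" using pos(1)[OF xy] p by simp
  qed (use F in auto)
  finally show "1 / c * dirichlet F R' f \<le> dirichlet E R f" .
qed

text \<open>This puts the event of positive capacity in the range of the zero-one law.\<close>

lemma positive_capacity_finite_change:
  assumes pos: "\<And>e. e \<in> E \<Longrightarrow> 0 < R e" "\<And>e. e \<in> E \<Longrightarrow> 0 < R' e"
    and fin: "finite {e \<in> E. R e \<noteq> R' e}" and cap: "positive_capacity V E R' v"
  shows "positive_capacity V E R v"
proof (rule positive_capacity_subgraph[OF subset_refl _ _ pos cap])
  define c where "c = Max (insert 1 ((\<lambda>e. R e / R' e) ` {e \<in> E. R e \<noteq> R' e}))"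
  have c1: "1 \<le> c" unfolding c_def using fin by (intro Max_ge) auto
  then show "0 < c" by simp
  show "R e \<le> c * R' e" if e: "e \<in> E" for e
  proof (cases "R e = R' e")
    case True then show ?thesis using c1 pos(2)[OF e] by simp
  next
    case False
    then have "R e / R' e \<le> c" unfolding c_def using fin e by (intro Max_ge) auto
    then show ?thesis using pos(2)[OF e] by (simp add: divide_le_eq)
  qed
qed

lemma simple_walk_eq: "simple_walk E = network_walk E (\<lambda>_. 1)"
proof
  fix x show "simple_walk E x = network_walk E (\<lambda>_. 1) x"
  proof (cases "neighbors E x = {}")
    case False
    show ?thesis
    proof (rule pmf_eqI)
      fix y show "pmf (simple_walk E x) y = pmf (network_walk E (\<lambda>_. 1) x) y"
        using False finite_neighbors[of x] by (simp add: pmf_network_walk simple_walk_def network_prob_def indicator_def)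
    qed
  qed (simp add: simple_walk_def network_walk_def)
qed

lemma simple_walk_transient_iff: "simple_walk_transient V E \<longleftrightarrow> network_transient V E (\<lambda>_. 1)"
  by (simp add: simple_walk_transient_def network_transient_def simple_walk_eq)

lemma unit_network: "resistor_network V E (\<lambda>_. 1)"
  by unfold_locales simp

lemma joined_sym: "joined E u w \<Longrightarrow> joined E w u"
  unfolding joined_def using sym_rtrancl[of "{(x, y). {x, y} \<in> E}"]
  by (auto simp: sym_def insert_commute)

text \<open>Cutting a test function off outside the cluster of \<open>v\<close> loses no edge on which it varies inside, so
the cluster has the same capacity at \<open>v\<close> as the whole graph.  This replaces a statement about the
walk on a random vertex set by one about a fixed countable family of test functions.\<close>

lemma cluster_transient_iff:
  assumes v: "v \<in> V"
  defines "C \<equiv> {w \<in> V. joined E v w}"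
  defines "EC \<equiv> {e \<in> E. e \<subseteq> C}"
  shows "simple_walk_transient C EC \<longleftrightarrow> positive_capacity V E (\<lambda>_. 1) v"
proof -
  have vC: "v \<in> C" using v by (simp add: C_def joined_def)
  have closed: "y \<in> C" if "x \<in> C" "{x, y} \<in> E" for x y
    using that edge_vertices[OF that(2)] by (auto simp: C_def joined_def intro: rtrancl_into_rtrancl)
  have edge: "{x, y} \<in> E \<Longrightarrow> x \<in> C \<or> y \<in> C \<Longrightarrow> {x, y} \<in> EC" for x y
    using closed[of x y] closed[of y x] by (auto simp: EC_def insert_commute)
  have EC: "EC \<subseteq> E" by (auto simp: EC_def)
  interpret C: lf_graph C EC
  proof
    show "simple_graph C EC" using simple by (fastforce simp: simple_graph_def EC_def)
    show "locally_finite C EC" using lf_graph.finite_neighbors[OF subgraph[OF EC]] by (simp add: locally_finite_def)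
  qed
  interpret CN: resistor_network C EC "\<lambda>_. 1" by (rule C.unit_network)
  have "joined EC v w" if "joined E v w" for w
    using that unfolding joined_def
  proof (induction rule: rtrancl_induct)
    case (step y z)
    have "y \<in> C" using step(1,2) edge_vertices[of y z] by (auto simp: C_def joined_def)
    then have "{y, z} \<in> EC" using edge step(2) by auto
    with step(3) show ?case by (auto intro: rtrancl_into_rtrancl)
  qed simp
  then have vj: "joined EC v w" if "w \<in> C" for w using that by (auto simp: C_def)
  have conn: "connected_graph C EC"
    unfolding connected_graph_def
  proof (intro conjI ballI)
    fix u w assume "u \<in> C" "w \<in> C"
    with vj C.joined_sym show "joined EC u w" unfolding joined_def by (meson rtrancl_trans)
  qed (use vC in blast)
  have "simple_walk_transient C EC \<longleftrightarrow> positive_capacity C EC (\<lambda>_. 1) v"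
    unfolding C.simple_walk_transient_iff by (rule CN.network_transient_iff_capacity[OF conn vC])
  also have "\<dots> \<longleftrightarrow> positive_capacity V E (\<lambda>_. 1) v"
  proof
    assume "positive_capacity C EC (\<lambda>_. 1) v"
    then obtain \<epsilon> where e: "\<epsilon> > 0" "\<And>f. f \<in> test_functions C v \<Longrightarrow> \<epsilon> \<le> dirichlet EC (\<lambda>_. 1) f"
      by (auto simp: positive_capacity_def)
    have "\<epsilon> \<le> dirichlet E (\<lambda>_. 1) f" if f: "f \<in> test_functions V v" for f
    proof -
      define g where "g x = (if x \<in> C then f x else 0)" for x
      have "{x. g x \<noteq> 0} \<subseteq> {x. f x \<noteq> 0}" by (auto simp: g_def)
      then have "g \<in> test_functions C v"
        using f vC unfolding test_functions_def by (auto simp: g_def intro: finite_subset split: if_splits)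
      then have "\<epsilon> \<le> dirichlet EC (\<lambda>_. 1) g" by (rule e(2))
      also have "\<dots> = dirichlet EC (\<lambda>_. 1) f"
        unfolding dirichlet_def by (intro sum.cong) (auto simp: g_def EC_def)
      also have "\<dots> \<le> dirichlet E (\<lambda>_. 1) f"
        unfolding dirichlet_def using EC by (intro sum_mono2 finite_test_arcs[OF f]) auto
      finally show ?thesis .
    qed
    with e(1) show "positive_capacity V E (\<lambda>_. 1) v" unfolding positive_capacity_def by blast
  next
    assume "positive_capacity V E (\<lambda>_. 1) v"
    then obtain \<epsilon> where e: "\<epsilon> > 0" "\<And>f. f \<in> test_functions V v \<Longrightarrow> \<epsilon> \<le> dirichlet E (\<lambda>_. 1) f"
      by (auto simp: positive_capacity_def)
    have "\<epsilon> \<le> dirichlet EC (\<lambda>_. 1) f" if f: "f \<in> test_functions C v" for f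
    proof -
      have f0: "f x = 0" if "x \<notin> C" for x using f that by (auto simp: test_functions_def)
      have "f \<in> test_functions V v" using f by (auto simp: test_functions_def C_def)
      then have "\<epsilon> \<le> dirichlet E (\<lambda>_. 1) f" by (rule e(2))
      also have "dirichlet E (\<lambda>_. 1) f = dirichlet EC (\<lambda>_. 1) f"
      proof -
        have "{x, y} \<in> EC" if "{x, y} \<in> E" "f x \<noteq> f y" for x y
          using edge[OF that(1)] f0[of x] f0[of y] that(2) by fastforce
        then have "{(x, y). {x, y} \<in> E \<and> f x \<noteq> f y} = {(x, y). {x, y} \<in> EC \<and> f x \<noteq> f y}"
          using EC by blast
        then show ?thesis unfolding dirichlet_def by simp
      qed
      finally show ?thesis .
    qed
    with e(1) show "positive_capacity C EC (\<lambda>_. 1) v" unfolding positive_capacity_def by blast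
  qed
  finally show ?thesis .
qed

lemma has_transient_cluster_iff:
  "has_transient_cluster V E \<longleftrightarrow> (\<exists>v\<in>V. positive_capacity V E (\<lambda>_. 1) v)"
  using cluster_transient_iff by (auto simp: has_transient_cluster_def clusters_def)

text \<open>Balls in a locally finite graph are finite, and they exhaust a connected one.\<close>

lemma countable_vertices:
  assumes conn: "connected_graph V E"
  shows "countable V"
proof -
  obtain v where v: "v \<in> V" using conn by (auto simp: connected_graph_def)
  let ?r = "{(x, y). {x, y} \<in> E}"
  have "finite ((?r ^^ n) `` {v})" for n
  proof (induction n)
    case (Suc n)
    have "(?r ^^ Suc n) `` {v} = (\<Union>x\<in>(?r ^^ n) `` {v}. neighbors E x)"
      by (auto simp: neighbors_def)
    then show ?case using Suc finite_neighbors by simp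
  qed simp
  then have "countable (\<Union>n. (?r ^^ n) `` {v})" by (intro countable_UN) (auto intro: countable_finite)
  moreover have "V \<subseteq> (\<Union>n. (?r ^^ n) `` {v})"
    using conn v by (auto simp: connected_graph_def joined_def rtrancl_power)
  ultimately show ?thesis by (rule countable_subset[rotated])
qed

lemma countable_edges:
  assumes "countable V"
  shows "countable E"
proof (rule countable_subset)
  show "E \<subseteq> (\<lambda>(x, y). {x, y}) ` (V \<times> V)" using simple by (fastforce simp: simple_graph_def)
qed (use assms in auto)

end

section \<open>Product measures\<close>

text \<open>Applying a function to every coordinate of an i.i.d. family gives an i.i.d. family.  All couplings
below are of this kind.\<close>

lemma distr_PiM_map:
  assumes N: "prob_space N" and f: "f \<in> measurable N N'"
  shows "distr (PiM I (\<lambda>_. N)) (PiM I (\<lambda>_. N')) (\<lambda>x. \<lambda>i\<in>I. f (x i)) = PiM I (\<lambda>_. distr N N' f)"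
    (is "distr ?K ?L ?t = ?P")
proof (rule measure_eqI_PiM_infinite[symmetric, OF refl])
  have D: "prob_space (distr N N' f)" using N f by (rule prob_space.prob_space_distr)
  interpret prob_space ?P by (intro prob_space_PiM D)
  show "finite_measure ?P" by unfold_locales
  have setsL: "sets ?L = sets ?P" by (intro sets_PiM_cong) auto
  then show "sets (distr ?K ?L ?t) = sets ?P" by simp
  have t: "?t \<in> measurable ?K ?L"
    using f by (intro measurable_restrict measurable_PiM_component_rev)
  fix A J assume J: "finite J" "J \<subseteq> I" and A: "\<And>i. i \<in> J \<Longrightarrow> A i \<in> sets (distr N N' f)"
  let ?C = "prod_emb I (\<lambda>_. distr N N' f) J (Pi\<^sub>E J A)"
  have C: "?C \<in> sets ?L" unfolding setsL using J A by (intro sets_PiM_I) auto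
  have "?P ?C = (\<Prod>j\<in>J. emeasure (distr N N' f) (A j))"
    using J A by (intro emeasure_PiM_emb D) auto
  also have "\<dots> = (\<Prod>j\<in>J. emeasure N (f -` A j \<inter> space N))"
    using A f by (intro prod.cong refl emeasure_distr) auto
  also have "\<dots> = ?K (prod_emb I (\<lambda>_. N) J (\<Pi>\<^sub>E j\<in>J. f -` A j \<inter> space N))"
    using J A f by (intro emeasure_PiM_emb[symmetric] N) (auto intro: measurable_sets)
  also have "prod_emb I (\<lambda>_. N) J (\<Pi>\<^sub>E j\<in>J. f -` A j \<inter> space N) = ?t -` ?C \<inter> space ?K"
  proof -
    have sub: "A j \<subseteq> space N'" if "j \<in> J" for j
      using sets.sets_into_space[OF A[OF that]] by simp
    have C: "?C = (\<Pi>\<^sub>E i\<in>I. if i \<in> J then A i else space N')"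
      using prod_emb_PiE[OF J(2), of A "\<lambda>_. distr N N' f"] sub unfolding space_distr by blast
    show ?thesis
      unfolding C prod_emb_PiE[OF J(2) Int_lower2]
      using measurable_space[OF f] by (auto simp: PiE_iff space_PiM split: if_splits) blast+
  qed
  also have "?K \<dots> = distr ?K ?L ?t ?C"
    using t C by (rule emeasure_distr[symmetric])
  finally show "?P ?C = distr ?K ?L ?t ?C" .
qed

lemma bernoulli_pmf_eqI:
  assumes "prob_space Q" "sets Q = UNIV"
  shows "Q = measure_pmf (bernoulli_pmf (measure Q {True}))"
proof (rule measure_eqI_finite[where A=UNIV])
  interpret Q: prob_space Q by fact
  let ?q = "measure Q {True}"
  have sp: "space Q = UNIV" using sets_eq_imp_space_eq[of Q "count_space UNIV"] assms(2) by simp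
  have "measure Q {False} = 1 - ?q"
    using Q.prob_compl[of "{True}"] assms(2) sp by (simp add: UNIV_bool insert_Diff_if)
  then show "emeasure Q {b} = emeasure (measure_pmf (bernoulli_pmf ?q)) {b}" for b
    by (cases b) (simp_all add: Q.emeasure_eq_measure emeasure_pmf_single)
qed (use assms in auto)

text \<open>An event \<open>A\<close> that is invariant under finite changes is determined by the coordinates off any finite
set \<open>J\<close>, hence independent of every cylinder over \<open>J\<close>.  Cylinders determine a measure, so \<open>A\<close> is
independent of all events, itself included.\<close>

lemma PiM_zero_one_law:
  assumes M: "\<And>i. prob_space (M i)" and A: "A \<in> sets (PiM I M)"
    and inv: "\<And>\<omega> \<omega>'. \<omega> \<in> space (PiM I M) \<Longrightarrow> \<omega>' \<in> space (PiM I M) \<Longrightarrow>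
      finite {i \<in> I. \<omega> i \<noteq> \<omega>' i} \<Longrightarrow> \<omega> \<in> A \<Longrightarrow> \<omega>' \<in> A"
  shows "measure (PiM I M) A = 0 \<or> measure (PiM I M) A = 1"
proof (cases "finite I")
  case True
  interpret P: prob_space "PiM I M" by (intro prob_space_PiM M)
  have "A = {} \<or> A = space (PiM I M)"
    using inv True sets.sets_into_space[OF A] by (auto intro: finite_subset[of _ I])
  then show ?thesis using P.prob_space by auto
next
  case False
  let ?P = "PiM I M"
  interpret P: prob_space ?P by (intro prob_space_PiM M)
  have ne: "I \<noteq> {}" using False by auto
  have comp: "distr ?P (M i) (\<lambda>\<omega>. \<omega> i) = M i" if "i \<in> I" for i
    using that by (intro distr_PiM_component M)
  have "distr ?P ?P (\<lambda>x. \<lambda>i\<in>I. x i) = distr ?P ?P (\<lambda>x. x)"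
    by (intro distr_cong refl) (auto simp: space_PiM)
  also have "\<dots> = PiM I (\<lambda>i. distr ?P (M i) (\<lambda>\<omega>. \<omega> i))"
    using comp by (subst distr_id) (rule PiM_cong, auto)
  finally have indep: "P.indep_vars M (\<lambda>i \<omega>. \<omega> i) I"
    by (subst P.indep_vars_iff_distr_eq_PiM'[OF ne]) auto
  obtain c where c: "c \<in> space ?P" using P.not_empty by blast
  have *: "emeasure ?P (A \<inter> prod_emb I M J (Pi\<^sub>E J X)) = emeasure ?P A * emeasure ?P (prod_emb I M J (Pi\<^sub>E J X))"
    if J: "finite J" "J \<subseteq> I" and X: "\<And>i. i \<in> J \<Longrightarrow> X i \<in> sets (M i)" for J X
  proof -
    \<comment> \<open>the coordinates in \<open>J\<close> are frozen, so that \<open>A\<close> is read off from the others\<close>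
    define T where "T \<eta> = (\<lambda>i\<in>I. if i \<in> J then c i else \<eta> i)" for \<eta>
    have T: "T \<in> measurable (PiM (I - J) M) ?P"
      unfolding T_def
    proof (rule measurable_restrict)
      fix i assume i: "i \<in> I"
      show "(\<lambda>\<eta>. if i \<in> J then c i else \<eta> i) \<in> measurable (PiM (I - J) M) (M i)"
        using i c by (cases "i \<in> J") (auto simp: space_PiM intro!: measurable_component_singleton measurable_const)
    qed
    define A' where "A' = T -` A \<inter> space (PiM (I - J) M)"
    have A': "A' \<in> sets (PiM (I - J) M)" unfolding A'_def using T A by (rule measurable_sets)
    have C: "Pi\<^sub>E J X \<in> sets (PiM J M)" using J X by (intro sets_PiM_I_finite)
    let ?r = "\<lambda>K \<omega>. restrict (\<lambda>i. \<omega> i) K"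
    have rA: "?r (I - J) -` A' \<inter> space ?P = A"
    proof -
      have "?r (I - J) \<omega> \<in> A' \<longleftrightarrow> \<omega> \<in> A" if w: "\<omega> \<in> space ?P" for \<omega>
      proof -
        have rs: "?r (I - J) \<omega> \<in> space (PiM (I - J) M)" using w by (auto simp: space_PiM)
        then have Ts: "T (?r (I - J) \<omega>) \<in> space ?P" using measurable_space[OF T] by blast
        have "{i \<in> I. \<omega> i \<noteq> T (?r (I - J) \<omega>) i} \<subseteq> J" "{i \<in> I. T (?r (I - J) \<omega>) i \<noteq> \<omega> i} \<subseteq> J"
          by (auto simp: T_def)
        then have "T (?r (I - J) \<omega>) \<in> A \<longleftrightarrow> \<omega> \<in> A"
          using inv[OF w Ts] inv[OF Ts w] J(1) finite_subset by blast
        then show ?thesis using rs by (simp add: A'_def)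
      qed
      then show ?thesis using sets.sets_into_space[OF A] by auto
    qed
    have rC: "?r J -` Pi\<^sub>E J X \<inter> space ?P = prod_emb I M J (Pi\<^sub>E J X)"
      by (auto simp: prod_emb_def space_PiM)
    have ind: "P.indep_var (PiM J M) (?r J) (PiM (I - J) M) (?r (I - J))"
      using J by (intro P.indep_var_restrict[OF indep]) auto
    have vimage_prod_eq: "(\<lambda>\<omega>. (?r J \<omega>, ?r (I - J) \<omega>)) -` (Pi\<^sub>E J X \<times> A') \<inter> space ?P = prod_emb I M J (Pi\<^sub>E J X) \<inter> A"
      unfolding rA[symmetric] rC[symmetric] by blast
    from P.indep_varD[OF ind C A']
    have "P.prob (prod_emb I M J (Pi\<^sub>E J X) \<inter> A) = P.prob (prod_emb I M J (Pi\<^sub>E J X)) * P.prob A"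
      unfolding rA rC vimage_prod_eq .
    then show ?thesis
      by (simp add: P.emeasure_eq_measure Int_commute mult.commute flip: ennreal_mult)
  qed
  have "density ?P (indicator A) = scale_measure (emeasure ?P A) ?P"
  proof (rule measure_eqI_PiM_infinite)
    fix X J assume J: "finite J" "J \<subseteq> I" and X: "\<And>i. i \<in> J \<Longrightarrow> X i \<in> sets (M i)"
    have "prod_emb I M J (Pi\<^sub>E J X) \<in> sets ?P" using J X by (intro sets_PiM_I) auto
    then show "density ?P (indicator A) (prod_emb I M J (Pi\<^sub>E J X)) = scale_measure (emeasure ?P A) ?P (prod_emb I M J (Pi\<^sub>E J X))"
      using *[OF J X] A by (simp add: emeasure_restricted)
  next
    show "finite_measure (density ?P (indicator A))"
      using A by (intro P.finite_measure_restricted)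
  qed auto
  from arg_cong[where f="\<lambda>Q. emeasure Q A", OF this]
  have "emeasure ?P A = emeasure ?P A * emeasure ?P A"
    using A by (simp add: emeasure_restricted)
  then have "P.prob A = P.prob A * P.prob A"
    by (simp add: P.emeasure_eq_measure flip: ennreal_mult)
  then show ?thesis by simp
qed

section \<open>Measurability\<close>

lemma sets_positive_capacity:
  assumes V: "countable V"
    and meas: "\<And>f. f \<in> test_functions V v \<Longrightarrow> (\<lambda>\<omega>. dirichlet (E \<omega>) (R \<omega>) f) \<in> borel_measurable M"
  shows "{\<omega> \<in> space M. positive_capacity V (E \<omega>) (R \<omega>) v} \<in> sets M"
  unfolding positive_capacity_iff_nat
proof (intro sets.sets_Collect_countable_Ex sets.sets_Collect_countable_All' countable_test_functions V)
  fix m :: nat and f assume f: "f \<in> test_functions V v"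
  note [measurable] = meas[OF f]
  show "{\<omega> \<in> space M. inverse (real (Suc m)) \<le> dirichlet (E \<omega>) (R \<omega>) f} \<in> sets M"
    by measurable
qed

text \<open>Resistances are positive only almost surely, whereas the zero-one law asks for invariance at every
point of the product space.  Replacing nonpositive values by \<open>1\<close> gives a network everywhere.\<close>

definition clip :: "real \<Rightarrow> real" where
  "clip r = (if 0 < r then r else 1)"

lemma clip_pos: "0 < clip r"
  by (simp add: clip_def)

lemma borel_measurable_clip[measurable]: "clip \<in> borel_measurable borel"
  unfolding clip_def by measurable

lemma measurable_dirichlet_clip:
  assumes "sets \<mu> = sets borel"
  shows "(\<lambda>R. dirichlet E (\<lambda>e. clip (R e)) f) \<in> borel_measurable (PiM E (\<lambda>_. \<mu>))"
  unfolding dirichlet_def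
proof (rule borel_measurable_sum)
  fix p assume "p \<in> {(x, y). {x, y} \<in> E \<and> f x \<noteq> f y}"
  then obtain x y where p: "p = (x, y)" and xy: "{x, y} \<in> E" by auto
  have "(\<lambda>R. R {x, y}) \<in> measurable (PiM E (\<lambda>_. \<mu>)) \<mu>"
    using xy by (rule measurable_component_singleton)
  then have [measurable]: "(\<lambda>R. R {x, y}) \<in> borel_measurable (PiM E (\<lambda>_. \<mu>))"
    using measurable_cong_sets[OF refl assms] by blast
  show "(\<lambda>R. case p of (x, y) \<Rightarrow> (f x - f y)\<^sup>2 / clip (R {x, y})) \<in> borel_measurable (PiM E (\<lambda>_. \<mu>))"
    unfolding p prod.case by measurable
qed

lemma (in lf_graph) dirichlet_open_edges:
  assumes f: "f \<in> test_functions U v"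
  shows "dirichlet (open_edges E \<omega>) (\<lambda>_. 1) f =
    (\<Sum>(x, y) | {x, y} \<in> E \<and> f x \<noteq> f y. if \<omega> {x, y} then (f x - f y)\<^sup>2 else 0)"
  unfolding dirichlet_def using finite_test_arcs[OF f]
  by (intro sum.mono_neutral_cong_left) (auto simp: open_edges_def split: if_splits)

lemma (in lf_graph) measurable_dirichlet_open:
  assumes f: "f \<in> test_functions U v"
  shows "(\<lambda>\<omega>. dirichlet (open_edges E \<omega>) (\<lambda>_. 1) f) \<in> borel_measurable (PiM E (\<lambda>_. count_space UNIV))"
  unfolding dirichlet_open_edges[OF f]
proof (rule borel_measurable_sum)
  fix p assume "p \<in> {(x, y). {x, y} \<in> E \<and> f x \<noteq> f y}"
  then obtain x y where p: "p = (x, y)" and xy: "{x, y} \<in> E" by auto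
  have [measurable]: "(\<lambda>\<omega>. \<omega> {x, y}) \<in> measurable (PiM E (\<lambda>_. count_space UNIV)) (count_space (UNIV :: bool set))"
    using xy by (rule measurable_component_singleton)
  show "(\<lambda>\<omega>. case p of (x, y) \<Rightarrow> if \<omega> {x, y} then (f x - f y)\<^sup>2 else 0) \<in> borel_measurable (PiM E (\<lambda>_. count_space UNIV))"
    unfolding p prod.case by measurable
qed

lemma (in lf_graph) open_edges_graph: "lf_graph V (open_edges E \<omega>)"
  by (rule subgraph) (auto simp: open_edges_def)

lemma (in lf_graph) transient_cluster_measurable:
  assumes "countable V"
  shows "{\<omega> \<in> space (bond_percolation E p). has_transient_cluster V (open_edges E \<omega>)} \<in> sets (bond_percolation E p)"
proof -
  have sets: "sets (bond_percolation E p) = sets (PiM E (\<lambda>_. count_space UNIV))"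
    unfolding bond_percolation_def by (intro sets_PiM_cong) auto
  have "{\<omega> \<in> space (bond_percolation E p). \<exists>v\<in>V. positive_capacity V (open_edges E \<omega>) (\<lambda>_. 1) v} \<in> sets (bond_percolation E p)"
    using assms measurable_dirichlet_open
    by (intro sets.sets_Collect_countable_Ex' sets_positive_capacity)
      (simp_all add: measurable_cong_sets[OF sets refl])
  then show ?thesis
    by (simp add: lf_graph.has_transient_cluster_iff[OF open_edges_graph])
qed

section \<open>Random resistances\<close>

lemma positive_distributionD:
  assumes "positive_distribution \<mu>"
  shows "prob_space \<mu>" "sets \<mu> = sets borel" "AE x in \<mu>. 0 < x"
  using assms by (auto simp: positive_distribution_def real_distribution_def real_distribution_axioms_def)

lemma AE_iid_resistances_pos:
  assumes \<mu>: "positive_distribution \<mu>" and E: "countable E"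
  shows "AE R in iid_resistances E \<mu>. \<forall>e\<in>E. 0 < R e"
  unfolding iid_resistances_def
  using positive_distributionD[OF \<mu>] E
  by (subst AE_ball_countable) (auto intro!: AE_PiM_component)

text \<open>A flow of finite energy for unit resistances serves for the random ones: by Fubini the mean of its
energy is multiplied by the mean resistance, so the energy is almost surely finite.\<close>

lemma (in lf_graph) finite_mean_resistance:
  assumes conn: "connected_graph V E" and \<mu>: "positive_distribution \<mu>"
    and mean: "(\<integral>\<^sup>+ x. ennreal x \<partial>\<mu>) < \<infinity>" and tr: "simple_walk_transient V E"
  shows "AE R in iid_resistances E \<mu>. finite_net_resistance V E R"
proof -
  interpret unit: resistor_network V E "\<lambda>_. 1" by (rule unit_network)
  have E: "countable E" using countable_edges[OF countable_vertices[OF conn]] .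
  obtain v where v: "v \<in> V" using conn by (auto simp: connected_graph_def)
  then have "finite_energy_flow V E (\<lambda>_. 1) v"
    using tr unfolding simple_walk_transient_iff unit.network_transient_iff_capacity[OF conn v]
    by (simp add: unit.positive_capacity_iff_flow)
  then obtain F where F: "unit_flow V E v F" and en: "energy E (\<lambda>_. 1) F < \<infinity>"
    by (auto simp: finite_energy_flow_def)
  let ?A = "{(x, y). {x, y} \<in> E}" and ?P = "iid_resistances E \<mu>"
  have A: "countable ?A"
  proof (rule countable_subset)
    show "?A \<subseteq> V \<times> V" using edge_vertices by auto
  qed (use countable_vertices[OF conn] in auto)
  interpret P: prob_space ?P
    unfolding iid_resistances_def by (intro prob_space_PiM positive_distributionD[OF \<mu>])
  define g where "g R p = (case p of (x, y) \<Rightarrow> ennreal ((F x y)\<^sup>2 * R {x, y}))" for R :: "'v set \<Rightarrow> real" and p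
  have g_meas: "(\<lambda>R. g R p) \<in> borel_measurable ?P" if pA: "p \<in> ?A" for p
  proof -
    obtain x y where p: "p = (x, y)" and xy: "{x, y} \<in> E" using pA by auto
    have "(\<lambda>R. R {x, y}) \<in> measurable ?P \<mu>"
      unfolding iid_resistances_def using xy by (rule measurable_component_singleton)
    then have [measurable]: "(\<lambda>R. R {x, y}) \<in> borel_measurable ?P"
      using measurable_cong_sets[OF refl positive_distributionD(2)[OF \<mu>]] by blast
    show ?thesis unfolding g_def p prod.case by measurable
  qed
  have g_int: "(\<integral>\<^sup>+ R. g R p \<partial>?P) = g (\<lambda>_. 1) p * (\<integral>\<^sup>+ x. ennreal x \<partial>\<mu>)" if pA: "p \<in> ?A" for p
  proof -
    obtain x y where p: "p = (x, y)" and xy: "{x, y} \<in> E" using pA by auto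
    have comp: "(\<lambda>R. R {x, y}) \<in> measurable ?P \<mu>"
      unfolding iid_resistances_def using xy by (rule measurable_component_singleton)
    have [measurable]: "(\<lambda>x. x) \<in> borel_measurable \<mu>"
      by (rule measurable_ident_sets[OF positive_distributionD(2)[OF \<mu>]])
    have "(\<integral>\<^sup>+ R. g R p \<partial>?P) = (\<integral>\<^sup>+ R. ennreal ((F x y)\<^sup>2) * ennreal (R {x, y}) \<partial>?P)"
      by (simp add: g_def p ennreal_mult')
    also have "\<dots> = (\<integral>\<^sup>+ r. ennreal ((F x y)\<^sup>2) * ennreal r \<partial>distr ?P \<mu> (\<lambda>R. R {x, y}))"
      by (subst nn_integral_distr[OF comp]) simp_all
    also have "distr ?P \<mu> (\<lambda>R. R {x, y}) = \<mu>"
      unfolding iid_resistances_def using xy by (intro distr_PiM_component positive_distributionD[OF \<mu>])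
    also have "(\<integral>\<^sup>+ r. ennreal ((F x y)\<^sup>2) * ennreal r \<partial>\<mu>) = ennreal ((F x y)\<^sup>2) * (\<integral>\<^sup>+ x. ennreal x \<partial>\<mu>)"
      by (rule nn_integral_cmult) simp
    finally show ?thesis by (simp add: g_def p)
  qed
  have "(\<integral>\<^sup>+ R. (\<integral>\<^sup>+ p. g R p \<partial>count_space ?A) \<partial>?P) = (\<integral>\<^sup>+ p. (\<integral>\<^sup>+ R. g R p \<partial>?P) \<partial>count_space ?A)"
    by (rule nn_integral_count_space_nn_integral[OF A g_meas])
  also have "\<dots> = (\<integral>\<^sup>+ p. g (\<lambda>_. 1) p * (\<integral>\<^sup>+ x. ennreal x \<partial>\<mu>) \<partial>count_space ?A)"
    by (rule nn_integral_cong) (simp add: g_int)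
  also have "\<dots> = (\<integral>\<^sup>+ p. g (\<lambda>_. 1) p \<partial>count_space ?A) * (\<integral>\<^sup>+ x. ennreal x \<partial>\<mu>)"
    by (rule nn_integral_multc) simp
  also have "\<dots> < \<infinity>"
    using en mean unfolding energy_def g_def
    by (simp add: ennreal_divide_eq_top_iff less_top[symmetric] ennreal_mult_eq_top_iff)
  finally have fin: "(\<integral>\<^sup>+ R. (\<integral>\<^sup>+ p. g R p \<partial>count_space ?A) \<partial>?P) \<noteq> \<infinity>" by simp
  interpret CA: sigma_finite_measure "count_space ?A"
    by (rule sigma_finite_measure_count_space_countable[OF A])
  have "(\<lambda>(p, R). g R p) \<in> borel_measurable (count_space ?A \<Otimes>\<^sub>M ?P)"
    using g_meas by (intro measurable_pair_measure_countable1[OF A]) simp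
  then have "(\<lambda>(R, p). g R p) \<in> borel_measurable (?P \<Otimes>\<^sub>M count_space ?A)"
    by (subst measurable_pair_swap_iff) (simp add: case_prod_beta)
  then have "(\<lambda>R. \<integral>\<^sup>+ p. g R p \<partial>count_space ?A) \<in> borel_measurable ?P"
    by (rule CA.borel_measurable_nn_integral)
  from nn_integral_PInf_AE[OF this fin]
  show ?thesis
  proof eventually_elim
    case (elim R)
    then have "energy E R F < \<infinity>"
      unfolding energy_def g_def by (simp add: ennreal_divide_eq_top_iff less_top[symmetric])
    with F v show ?case
      unfolding finite_net_resistance_def net_resistance_finite_iff finite_energy_flow_def by blast
  qed
qed

lemma (in lf_graph) capacity_zero_one:
  fixes v :: 'v
  assumes V: "countable V" and \<mu>: "positive_distribution \<mu>"
  defines "A \<equiv> {R \<in> space (iid_resistances E \<mu>). positive_capacity V E (\<lambda>e. clip (R e)) v}"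
  shows "A \<in> sets (iid_resistances E \<mu>)"
    and "measure (iid_resistances E \<mu>) A = 0 \<or> measure (iid_resistances E \<mu>) A = 1"
proof -
  show A: "A \<in> sets (iid_resistances E \<mu>)"
    unfolding A_def iid_resistances_def
    by (intro sets_positive_capacity V measurable_dirichlet_clip positive_distributionD[OF \<mu>])
  show "measure (iid_resistances E \<mu>) A = 0 \<or> measure (iid_resistances E \<mu>) A = 1"
    unfolding iid_resistances_def
  proof (rule PiM_zero_one_law)
    show "prob_space \<mu>" by (rule positive_distributionD[OF \<mu>])
    show "A \<in> sets (PiM E (\<lambda>_. \<mu>))" using A by (simp add: iid_resistances_def)
    fix R R' assume R': "R' \<in> space (PiM E (\<lambda>_. \<mu>))" and fin: "finite {e \<in> E. R e \<noteq> R' e}" and RA: "R \<in> A"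
    have "positive_capacity V E (\<lambda>e. clip (R' e)) v"
    proof (rule positive_capacity_finite_change)
      have "{e \<in> E. clip (R' e) \<noteq> clip (R e)} \<subseteq> {e \<in> E. R e \<noteq> R' e}" by auto
      then show "finite {e \<in> E. clip (R' e) \<noteq> clip (R e)}" using fin by (rule finite_subset)
      show "positive_capacity V E (\<lambda>e. clip (R e)) v" using RA by (simp add: A_def)
    qed (rule clip_pos)+
    then show "R' \<in> A" using R' by (simp add: A_def iid_resistances_def)
  qed
qed

lemma (in lf_graph) AE_network_transient_iff:
  assumes conn: "connected_graph V E" and v: "v \<in> V" and \<mu>: "positive_distribution \<mu>"
  shows "(AE R in iid_resistances E \<mu>. network_transient V E R) \<longleftrightarrow>
    (AE R in iid_resistances E \<mu>. positive_capacity V E (\<lambda>e. clip (R e)) v)"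
proof (rule eventually_subst)
  have E: "countable E" using countable_edges[OF countable_vertices[OF conn]] .
  show "AE R in iid_resistances E \<mu>. network_transient V E R = positive_capacity V E (\<lambda>e. clip (R e)) v"
    using AE_iid_resistances_pos[OF \<mu> E]
  proof eventually_elim
    case (elim R)
    then interpret resistor_network V E R by unfold_locales simp
    have "positive_capacity V E (\<lambda>e. clip (R e)) v = positive_capacity V E R v"
      using elim by (intro positive_capacity_cong) (simp add: clip_def)
    then show ?case using network_transient_iff_capacity[OF conn v] by simp
  qed
qed

text \<open>Choose \<open>M\<close> such that \<open>q = \<mu> {..M}\<close> exceeds \<open>p\<close>.  Retaining the edges of resistance at most \<open>M\<close> with
an independent probability \<open>p / q\<close> realizes percolation of parameter \<open>p\<close> inside the set of edges
with bounded resistance; a transient cluster there makes the network transient by monotonicity.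
This happens with positive probability, hence almost surely by the zero-one law.\<close>

lemma (in lf_graph) percolation_imp_transient:
  assumes conn: "connected_graph V E" and \<mu>: "positive_distribution \<mu>"
    and p: "0 \<le> p" "p < 1"
    and perc: "0 < measure (bond_percolation E p)
      {\<omega> \<in> space (bond_percolation E p). has_transient_cluster V (open_edges E \<omega>)}" (is "0 < measure ?B ?T")
  shows "AE R in iid_resistances E \<mu>. network_transient V E R"
proof -
  have V: "countable V" using countable_vertices[OF conn] .
  obtain v where v: "v \<in> V" using conn by (auto simp: connected_graph_def)
  interpret \<mu>: real_distribution \<mu> using \<mu> by (simp add: positive_distribution_def)
  obtain M where M: "p < measure \<mu> {..M}"
    using order_tendstoD(1)[OF \<mu>.cdf_lim_at_top_prob p(2)]
    by (auto simp: eventually_at_top_linorder cdf_def)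
  define q where "q = measure \<mu> {..M}"
  have q: "0 < q" "p < q" "q \<le> 1" using M p by (auto simp: q_def)
  define N where "N = \<mu> \<Otimes>\<^sub>M measure_pmf (bernoulli_pmf (p / q))"
  define g where "g z = (fst z \<le> M \<and> snd z)" for z :: "real \<times> bool"
  have N: "prob_space N"
    unfolding N_def by (intro prob_space_pair \<mu>.prob_space_axioms prob_space_measure_pmf)
  have fst_N: "fst \<in> measurable N \<mu>" by (simp add: N_def)
  have g_N: "g \<in> measurable N (count_space UNIV)"
    unfolding N_def g_def by measurable
  have distr_fst: "distr N \<mu> fst = \<mu>"
    unfolding N_def by (rule prob_space.distr_pair_fst[OF prob_space_measure_pmf])
  have distr_g: "distr N (count_space UNIV) g = measure_pmf (bernoulli_pmf p)"
  proof -
    have "measure (distr N (count_space UNIV) g) {True} = measure N ({..M} \<times> {True})"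
    proof (subst measure_distr[OF g_N])
      have "g -` {True} \<inter> space N = {..M} \<times> {True}"
      proof (rule set_eqI)
        fix z :: "real \<times> bool"
        have "z \<in> space N"
          unfolding N_def space_pair_measure \<mu>.space_eq_univ by (cases z) simp
        then show "z \<in> g -` {True} \<inter> space N \<longleftrightarrow> z \<in> {..M} \<times> {True}"
          by (cases z) (simp add: g_def)
      qed
      then show "measure N (g -` {True} \<inter> space N) = measure N ({..M} \<times> {True})" by (rule arg_cong)
    qed simp
    also have "\<dots> = q * (p / q)"
    proof -
      have "emeasure N ({..M} \<times> {True}) = emeasure \<mu> {..M} * emeasure (measure_pmf (bernoulli_pmf (p / q))) {True}"
        unfolding N_def by (rule measure_pmf.emeasure_pair_measure_Times) auto
      also have "\<dots> = ennreal q * ennreal (p / q)"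
        using p q by (simp add: \<mu>.emeasure_eq_measure q_def[symmetric] emeasure_pmf_single)
      also have "\<dots> = ennreal (q * (p / q))"
        using p q by (intro ennreal_mult[symmetric]) auto
      finally show ?thesis using p q by (simp add: measure_def)
    qed
    also have "\<dots> = p" using q by simp
    finally have "measure (distr N (count_space UNIV) g) {True} = p" .
    then show ?thesis
      using bernoulli_pmf_eqI[OF prob_space.prob_space_distr[OF N g_N]] by simp
  qed
  define \<rho> where "\<rho> x = (\<lambda>e\<in>E. fst (x e))" for x :: "'v set \<Rightarrow> real \<times> bool"
  define \<beta> where "\<beta> x = (\<lambda>e\<in>E. g (x e))" for x :: "'v set \<Rightarrow> real \<times> bool"
  let ?P = "PiM E (\<lambda>_. N)"
  interpret P: prob_space ?P by (intro prob_space_PiM N)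
  have \<rho>: "\<rho> \<in> measurable ?P (iid_resistances E \<mu>)"
    unfolding \<rho>_def iid_resistances_def by (intro measurable_restrict measurable_PiM_component_rev fst_N)
  have \<beta>: "\<beta> \<in> measurable ?P (PiM E (\<lambda>_. count_space UNIV))"
    unfolding \<beta>_def by (intro measurable_restrict measurable_PiM_component_rev g_N)
  have \<rho>_law: "distr ?P (iid_resistances E \<mu>) \<rho> = iid_resistances E \<mu>"
    using distr_PiM_map[OF N fst_N, of E] unfolding \<rho>_def distr_fst iid_resistances_def .
  have \<beta>_law: "distr ?P (PiM E (\<lambda>_. count_space UNIV)) \<beta> = ?B"
    using distr_PiM_map[OF N g_N, of E] unfolding \<beta>_def distr_g bond_percolation_def .
  define A where "A = {R \<in> space (iid_resistances E \<mu>). positive_capacity V E (\<lambda>e. clip (R e)) v}"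
  have A: "A \<in> sets (iid_resistances E \<mu>)" and zo: "measure (iid_resistances E \<mu>) A = 0 \<or> measure (iid_resistances E \<mu>) A = 1"
    unfolding A_def by (rule capacity_zero_one[OF V \<mu>])+
  have T: "?T \<in> sets ?B" by (rule transient_cluster_measurable[OF V])
  have setsB: "sets ?B = sets (PiM E (\<lambda>_. count_space UNIV))"
    unfolding bond_percolation_def by (intro sets_PiM_cong) auto
  have sub: "\<beta> -` ?T \<inter> space ?P \<subseteq> \<rho> -` A \<inter> space ?P"
  proof
    fix x assume x: "x \<in> \<beta> -` ?T \<inter> space ?P"
    let ?F = "open_edges E (\<beta> x)" and ?R = "\<lambda>e. clip (\<rho> x e)"
    have F: "e \<in> E \<and> fst (x e) \<le> M" if "e \<in> ?F" for e
      using that by (auto simp: open_edges_def \<beta>_def g_def)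
    interpret net: resistor_network V E ?R by unfold_locales (rule clip_pos)
    obtain w where w: "w \<in> V" "positive_capacity V ?F (\<lambda>_. 1) w"
      using x by (auto simp: lf_graph.has_transient_cluster_iff[OF open_edges_graph])
    have "positive_capacity V E ?R w"
    proof (rule positive_capacity_subgraph[OF _ _ _ _ _ w(2)])
      show "?R e \<le> max 1 M * 1" if "e \<in> ?F" for e
        using F[OF that] by (auto simp: \<rho>_def clip_def)
    qed (use F clip_pos in auto)
    then have "positive_capacity V E ?R v"
      using net.network_transient_iff_capacity[OF conn w(1)] net.network_transient_iff_capacity[OF conn v] by simp
    moreover have "\<rho> x \<in> space (iid_resistances E \<mu>)" using x measurable_space[OF \<rho>] by blast
    ultimately show "x \<in> \<rho> -` A \<inter> space ?P" using x by (simp add: A_def)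
  qed
  have "measure ?B ?T = measure ?P (\<beta> -` ?T \<inter> space ?P)"
    using measure_distr[OF \<beta>, of ?T] T setsB by (simp add: \<beta>_law)
  also have "\<dots> \<le> measure ?P (\<rho> -` A \<inter> space ?P)"
    using sub measurable_sets[OF \<rho> A] by (rule P.finite_measure_mono)
  also have "\<dots> = measure (iid_resistances E \<mu>) A"
    using measure_distr[OF \<rho> A] by (simp add: \<rho>_law)
  finally have one: "measure (iid_resistances E \<mu>) A = 1" using perc zo by linarith
  interpret I: prob_space "iid_resistances E \<mu>"
    unfolding iid_resistances_def by (intro prob_space_PiM \<mu>.prob_space_axioms)
  have "AE R in iid_resistances E \<mu>. R \<in> A" using one A by (simp add: I.prob_eq_1)
  then show ?thesis
    unfolding AE_network_transient_iff[OF conn v \<mu>] by eventually_elim (simp add: A_def)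
qed

lemma (in prob_space) ex_prob_gt_incseq:
  assumes A: "\<And>n. A n \<in> events" "incseq A" and AE: "AE x in M. \<exists>n. x \<in> A n" and c: "c < 1"
  shows "\<exists>n. c < prob (A n)"
proof -
  have "(\<lambda>n. prob (A n)) \<longlonglongrightarrow> prob (\<Union>n. A n)"
    using A by (intro finite_Lim_measure_incseq) auto
  moreover have "prob (\<Union>n. A n) = 1"
  proof (subst prob_eq_1)
    show "(\<Union>n. A n) \<in> events" using A(1) by blast
    show "AE x in M. x \<in> (\<Union>n. A n)" using AE by simp
  qed
  ultimately have "eventually (\<lambda>n. c < prob (A n)) sequentially"
    using c by (metis order_tendstoD(1))
  then show ?thesis by (auto simp: eventually_sequentially)
qed

text \<open>If the closed edges are so resistive that even the whole energy of \<open>f\<close>, divided by their resistance,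
is negligible, then the energy is essentially that of the open subgraph.\<close>

lemma (in lf_graph) dirichlet_truncation:
  assumes f: "f \<in> test_functions V v"
    and one: "\<And>e. e \<in> E \<Longrightarrow> 1 \<le> R e"
    and large: "\<And>e. e \<in> E \<Longrightarrow> \<not> \<omega> e \<Longrightarrow> 1 + c * dirichlet E (\<lambda>_. 1) f \<le> R e"
    and c: "0 < c"
  shows "dirichlet E R f \<le> dirichlet (open_edges E \<omega>) (\<lambda>_. 1) f + 1 / c"
proof -
  let ?T = "{(x, y). {x, y} \<in> E \<and> f x \<noteq> f y}" and ?D = "dirichlet E (\<lambda>_. 1) f"
  have D0: "0 \<le> ?D" unfolding dirichlet_def by (intro sum_nonneg) auto
  then have pos: "0 < 1 + c * ?D" using c by (simp add: add_pos_nonneg)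
  have "dirichlet E R f \<le> (\<Sum>p\<in>?T. (case p of (x, y) \<Rightarrow> if \<omega> {x, y} then (f x - f y)\<^sup>2 else 0) + (case p of (x, y) \<Rightarrow> (f x - f y)\<^sup>2 / 1) / (1 + c * ?D))"
    unfolding dirichlet_def[of E R]
  proof (rule sum_mono)
    fix p assume "p \<in> ?T"
    then obtain x y where p: "p = (x, y)" and xy: "{x, y} \<in> E" by auto
    have "(f x - f y)\<^sup>2 / R {x, y} \<le> (if \<omega> {x, y} then (f x - f y)\<^sup>2 else 0) + (f x - f y)\<^sup>2 / 1 / (1 + c * ?D)"
    proof (cases "\<omega> {x, y}")
      case True
      have "(f x - f y)\<^sup>2 / R {x, y} \<le> (f x - f y)\<^sup>2 / 1"
        using one[OF xy] by (intro divide_left_mono) auto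
      moreover have "0 \<le> (f x - f y)\<^sup>2 / 1 / (1 + c * ?D)" using pos by simp
      ultimately show ?thesis using True by simp
    next
      case False
      have "(f x - f y)\<^sup>2 / R {x, y} \<le> (f x - f y)\<^sup>2 / (1 + c * ?D)"
        using large[OF xy False] pos one[OF xy] by (intro divide_left_mono mult_pos_pos) auto
      then show ?thesis using False by simp
    qed
    then show "(case p of (x, y) \<Rightarrow> (f x - f y)\<^sup>2 / R {x, y}) \<le> (case p of (x, y) \<Rightarrow> if \<omega> {x, y} then (f x - f y)\<^sup>2 else 0) + (case p of (x, y) \<Rightarrow> (f x - f y)\<^sup>2 / 1) / (1 + c * ?D)"
      by (simp only: p prod.case)
  qed
  also have "\<dots> = dirichlet (open_edges E \<omega>) (\<lambda>_. 1) f + ?D / (1 + c * ?D)"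
    unfolding sum.distrib dirichlet_open_edges[OF f] sum_divide_distrib[symmetric] dirichlet_def[of E "\<lambda>_. 1"] ..
  also have "?D / (1 + c * ?D) \<le> 1 / c"
    using c pos by (simp add: divide_simps)
  finally show ?thesis by simp
qed

text \<open>The contrapositive is proved by constructing a distribution with a very heavy tail.  Give the edges
i.i.d. geometric labels.  For each \<open>k\<close> the edges with label at most \<open>k\<close> form a percolation with
parameter less than \<open>1\<close>, where \<open>v\<close> almost surely lies in a recurrent cluster; so with probability
more than \<open>1 / 2\<close> one of finitely many test functions, with indices up to \<open>N k\<close>, has energy below
\<open>1 / Suc k\<close> there.  As their number is finite, the resistances \<open>M j\<close> for labels \<open>j > k\<close> can be chosen
so large that the remaining edges contribute at most another \<open>1 / Suc k\<close>.  With this choice for all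
\<open>k\<close> at once, each positive lower bound on the capacity fails with probability more than \<open>1 / 2\<close>,
so the network is not almost surely transient.\<close>

lemma (in lf_graph) transient_imp_percolation:
  assumes conn: "connected_graph V E"
    and all: "\<And>\<mu>. positive_distribution \<mu> \<Longrightarrow> AE R in iid_resistances E \<mu>. network_transient V E R"
  shows "\<exists>p. 0 \<le> p \<and> p < 1 \<and> 0 < measure (bond_percolation E p)
    {\<omega> \<in> space (bond_percolation E p). has_transient_cluster V (open_edges E \<omega>)}"
proof (rule ccontr)
  assume no: "\<not> ?thesis"
  have V: "countable V" using countable_vertices[OF conn] .
  obtain v where v: "v \<in> V" using conn by (auto simp: connected_graph_def)
  define G where "G = geometric_pmf (1 / 2 :: real)"
  define \<Lambda> where "\<Lambda> = PiM E (\<lambda>_. measure_pmf G)"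
  interpret \<Lambda>: prob_space \<Lambda> unfolding \<Lambda>_def by (intro prob_space_PiM prob_space_measure_pmf)
  define q where "q k = measure (measure_pmf G) {..k}" for k
  have q: "0 \<le> q k" "q k < 1" for k
  proof -
    show "0 \<le> q k" by (simp add: q_def)
    have "q k + pmf G (Suc k) = measure (measure_pmf G) ({..k} \<union> {Suc k})"
      unfolding q_def pmf.rep_eq by (rule measure_pmf.finite_measure_Union[symmetric]) auto
    also have "\<dots> \<le> 1" by simp
    finally have "q k + pmf G (Suc k) \<le> 1" .
    moreover have "0 < pmf G (Suc k)"
      by (rule pmf_positive) (simp add: G_def set_pmf_geometric)
    ultimately show "q k < 1" by linarith
  qed
  define \<theta> where "\<theta> k L = (\<lambda>e\<in>E. L e \<le> k)" for k :: nat and L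
  have \<theta>: "\<theta> k \<in> measurable \<Lambda> (PiM E (\<lambda>_. count_space UNIV))" for k
    unfolding \<theta>_def \<Lambda>_def by (intro measurable_restrict measurable_PiM_component_rev) auto
  have \<theta>_law: "distr \<Lambda> (PiM E (\<lambda>_. count_space UNIV)) (\<theta> k) = bond_percolation E (q k)" for k
  proof -
    have m: "(\<lambda>l. l \<le> k) \<in> measurable (measure_pmf G) (count_space UNIV)" by simp
    have "measure (distr (measure_pmf G) (count_space UNIV) (\<lambda>l. l \<le> k)) {True} = q k"
      by (subst measure_distr) (auto simp: q_def vimage_def atMost_def)
    then have "distr (measure_pmf G) (count_space UNIV) (\<lambda>l. l \<le> k) = measure_pmf (bernoulli_pmf (q k))"
      using bernoulli_pmf_eqI[OF prob_space.prob_space_distr[OF prob_space_measure_pmf m]] by simp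
    then show ?thesis
      using distr_PiM_map[OF prob_space_measure_pmf m, of E]
      unfolding \<theta>_def \<Lambda>_def bond_percolation_def by simp
  qed
  have rec: "AE L in \<Lambda>. \<not> positive_capacity V (open_edges E (\<theta> k L)) (\<lambda>_. 1) v" for k
  proof (rule AE_distrD[OF \<theta>], unfold \<theta>_law)
    let ?B = "bond_percolation E (q k)"
    interpret B: prob_space ?B
      unfolding bond_percolation_def by (intro prob_space_PiM prob_space_measure_pmf)
    let ?T = "{\<omega> \<in> space ?B. has_transient_cluster V (open_edges E \<omega>)}"
    have "measure ?B ?T = 0"
    proof (rule ccontr)
      assume "measure ?B ?T \<noteq> 0"
      then have "0 < measure ?B ?T" by (simp add: zero_less_measure_iff)
      with no q[of k] show False by blast
    qed
    then have "AE \<omega> in ?B. \<omega> \<notin> ?T"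
      using B.prob_eq_0[OF transient_cluster_measurable[OF V]] by simp
    then show "AE \<omega> in ?B. \<not> positive_capacity V (open_edges E \<omega>) (\<lambda>_. 1) v"
      using AE_space
    proof eventually_elim
      case (elim \<omega>)
      then show ?case using v by (auto simp: lf_graph.has_transient_cluster_iff[OF open_edges_graph])
    qed
  qed
  define \<phi> where "\<phi> = from_nat_into (test_functions V v)"
  have ne: "test_functions V v \<noteq> {}" using unit_test_function[OF v] by blast
  have \<phi>: "\<phi> i \<in> test_functions V v" for i unfolding \<phi>_def by (rule from_nat_into[OF ne])
  have \<phi>_range: "range \<phi> = test_functions V v"
    unfolding \<phi>_def by (rule range_from_nat_into[OF ne countable_test_functions[OF V]])
  define B where "B k n = {L \<in> space \<Lambda>. \<exists>i\<in>{..n}. dirichlet (open_edges E (\<theta> k L)) (\<lambda>_. 1) (\<phi> i) < 1 / real (Suc k)}" for k n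
  have B_sets: "B k n \<in> sets \<Lambda>" for k n
    unfolding B_def
  proof (intro sets.sets_Collect_countable_Ex')
    fix i
    have [measurable]: "(\<lambda>L. dirichlet (open_edges E (\<theta> k L)) (\<lambda>_. 1) (\<phi> i)) \<in> borel_measurable \<Lambda>"
      using measurable_compose[OF \<theta> measurable_dirichlet_open[OF \<phi>]] .
    show "{L \<in> space \<Lambda>. dirichlet (open_edges E (\<theta> k L)) (\<lambda>_. 1) (\<phi> i) < 1 / real (Suc k)} \<in> sets \<Lambda>"
      by measurable
  qed auto
  have "\<exists>n. 1 / 2 < measure \<Lambda> (B k n)" for k
  proof (rule \<Lambda>.ex_prob_gt_incseq)
    show "incseq (B k)" by (auto simp: incseq_def B_def intro: order_trans)
    show "AE L in \<Lambda>. \<exists>n. L \<in> B k n"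
      using rec[of k] AE_space
    proof eventually_elim
      case (elim L)
      have "0 < 1 / real (Suc k)" by simp
      with elim(1) obtain f where "f \<in> test_functions V v" "dirichlet (open_edges E (\<theta> k L)) (\<lambda>_. 1) f < 1 / real (Suc k)"
        unfolding positive_capacity_def by (meson not_le)
      then obtain i where "dirichlet (open_edges E (\<theta> k L)) (\<lambda>_. 1) (\<phi> i) < 1 / real (Suc k)"
        unfolding \<phi>_range[symmetric] by blast
      then show ?case using elim(2) unfolding B_def by blast
    qed
  qed (simp_all add: B_sets)
  then obtain N where N: "1 / 2 < measure \<Lambda> (B k (N k))" for k by metis
  define D where "D f = dirichlet E (\<lambda>_. 1) f" for f
  have D0: "0 \<le> D f" for f unfolding D_def dirichlet_def by (intro sum_nonneg) auto
  \<comment> \<open>the summand \<open>1\<close> lets unit resistances bound the energy on the open edges\<close>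
  define M where "M j = 1 + (\<Sum>k\<le>j. \<Sum>i\<le>N k. real (Suc k) * D (\<phi> i))" for j
  have M1: "1 \<le> M j" for j unfolding M_def using D0 by (simp add: sum_nonneg)
  have M_large: "1 + real (Suc k) * D (\<phi> i) \<le> M j" if "k \<le> j" "i \<le> N k" for k i j
  proof -
    have "real (Suc k) * D (\<phi> i) \<le> (\<Sum>i\<le>N k. real (Suc k) * D (\<phi> i))"
      using that D0 by (intro member_le_sum) auto
    also have "\<dots> \<le> (\<Sum>k\<le>j. \<Sum>i\<le>N k. real (Suc k) * D (\<phi> i))"
      using that D0 by (intro member_le_sum[where f="\<lambda>k. \<Sum>i\<le>N k. real (Suc k) * D (\<phi> i)"] sum_nonneg) auto
    finally show ?thesis by (simp add: M_def)
  qed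
  define \<mu> where "\<mu> = distr (measure_pmf G) borel M"
  have M_meas: "M \<in> measurable (measure_pmf G) borel" by simp
  have \<mu>: "positive_distribution \<mu>"
    unfolding positive_distribution_def
  proof
    show "real_distribution \<mu>"
      unfolding \<mu>_def real_distribution_def real_distribution_axioms_def
      by (simp add: measure_pmf.prob_space_distr)
    have "0 < M j" for j using M1[of j] by simp
    then show "AE x in \<mu>. 0 < x" unfolding \<mu>_def by (subst AE_distr_iff) auto
  qed
  define \<psi> where "\<psi> L = (\<lambda>e\<in>E. M (L e))" for L
  have \<psi>: "\<psi> \<in> measurable \<Lambda> (PiM E (\<lambda>_. borel))"
    unfolding \<psi>_def \<Lambda>_def by (intro measurable_restrict measurable_PiM_component_rev) auto
  have \<psi>_law: "distr \<Lambda> (PiM E (\<lambda>_. borel)) \<psi> = iid_resistances E \<mu>"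
    using distr_PiM_map[OF prob_space_measure_pmf M_meas, of E]
    unfolding \<psi>_def \<Lambda>_def iid_resistances_def \<mu>_def .
  have tr: "AE L in \<Lambda>. positive_capacity V E (\<lambda>e. clip (\<psi> L e)) v"
    using AE_network_transient_iff[OF conn v \<mu>, THEN iffD1, OF all[OF \<mu>]] unfolding \<psi>_law[symmetric]
    by (rule AE_distrD[OF \<psi>])
  define C where "C m = {L \<in> space \<Lambda>. \<forall>f\<in>test_functions V v. inverse (real (Suc m)) \<le> dirichlet E (\<lambda>e. clip (\<psi> L e)) f}" for m
  have C_sets: "C m \<in> sets \<Lambda>" for m
    unfolding C_def
  proof (intro sets.sets_Collect_countable_All' countable_test_functions V)
    fix f
    have [measurable]: "(\<lambda>L. dirichlet E (\<lambda>e. clip (\<psi> L e)) f) \<in> borel_measurable \<Lambda>"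
      using measurable_compose[OF \<psi> measurable_dirichlet_clip[OF refl]] .
    show "{L \<in> space \<Lambda>. inverse (real (Suc m)) \<le> dirichlet E (\<lambda>e. clip (\<psi> L e)) f} \<in> sets \<Lambda>"
      by measurable
  qed
  have "\<exists>m. 1 / 2 < measure \<Lambda> (C m)"
  proof (rule \<Lambda>.ex_prob_gt_incseq)
    show "incseq C"
    proof (rule incseq_SucI)
      fix m
      have "inverse (real (Suc (Suc m))) \<le> inverse (real (Suc m))" by (simp add: field_simps)
      then show "C m \<le> C (Suc m)" unfolding C_def by (blast intro: order_trans)
    qed
    show "AE L in \<Lambda>. \<exists>m. L \<in> C m"
      using tr AE_space by eventually_elim (auto simp: positive_capacity_iff_nat C_def)
  qed (simp_all add: C_sets)
  then obtain m where m: "1 / 2 < measure \<Lambda> (C m)" ..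
  \<comment> \<open>large enough for \<open>2 / Suc k < 1 / Suc m\<close>\<close>
  define k where "k = 2 * m + 2"
  have disj: "B k (N k) \<inter> C m = {}"
  proof (rule ccontr)
    assume "\<not> ?thesis"
    then obtain L i where LC: "L \<in> C m" and i: "i \<le> N k"
      and small: "dirichlet (open_edges E (\<theta> k L)) (\<lambda>_. 1) (\<phi> i) < 1 / real (Suc k)"
      by (auto simp: B_def)
    have "inverse (real (Suc m)) \<le> dirichlet E (\<lambda>e. clip (\<psi> L e)) (\<phi> i)"
      using LC \<phi> by (simp add: C_def)
    also have "\<dots> \<le> dirichlet (open_edges E (\<theta> k L)) (\<lambda>_. 1) (\<phi> i) + 1 / real (Suc k)"
    proof (rule dirichlet_truncation[OF \<phi>])
      fix e assume e: "e \<in> E"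
      have R: "clip (\<psi> L e) = M (L e)" using e M1[of "L e"] by (simp add: \<psi>_def clip_def)
      show "1 \<le> clip (\<psi> L e)" unfolding R by (rule M1)
      assume "\<not> \<theta> k L e"
      then show "1 + real (Suc k) * dirichlet E (\<lambda>_. 1) (\<phi> i) \<le> clip (\<psi> L e)"
        unfolding R D_def[symmetric] using e by (intro M_large i) (simp add: \<theta>_def)
    qed simp
    also have "\<dots> < 2 / real (Suc k)" using small by simp
    also have "\<dots> < inverse (real (Suc m))" by (simp add: k_def field_simps)
    finally show False .
  qed
  have "measure \<Lambda> (B k (N k)) + measure \<Lambda> (C m) = measure \<Lambda> (B k (N k) \<union> C m)"
    by (rule \<Lambda>.finite_measure_Union[symmetric]) (use B_sets C_sets disj in auto)
  also have "\<dots> \<le> 1" by (rule \<Lambda>.prob_le_1)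
  finally show False using N[of k] m by simp
qed

theorem mainTheorem1:
  fixes V :: "'v set" and E :: "'v set set"
  assumes "simple_graph V E" and "locally_finite V E" and "connected_graph V E"
  shows
    "(\<forall>\<mu>. positive_distribution \<mu> \<longrightarrow> (\<integral>\<^sup>+ x. ennreal x \<partial>\<mu>) < \<infinity> \<longrightarrow> simple_walk_transient V E \<longrightarrow>
        (AE R in iid_resistances E \<mu>. finite_net_resistance V E R) \<and>
        (AE R in iid_resistances E \<mu>. network_transient V E R))
     \<and>
     ((\<forall>\<mu>. positive_distribution \<mu> \<longrightarrow> (AE R in iid_resistances E \<mu>. network_transient V E R))
      \<longleftrightarrow>
      (\<exists>p. 0 \<le> p \<and> p < 1 \<and>
         0 < measure (bond_percolation E p)
               {\<omega> \<in> space (bond_percolation E p). has_transient_cluster V (open_edges E \<omega>)}))"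
proof -
  interpret lf_graph V E using assms(1,2) by unfold_locales
  note conn = assms(3)
  show ?thesis
  proof (intro conjI allI impI)
    fix \<mu> :: "real measure"
    assume \<mu>: "positive_distribution \<mu>" and mean: "(\<integral>\<^sup>+ x. ennreal x \<partial>\<mu>) < \<infinity>"
      and tr: "simple_walk_transient V E"
    show fin: "AE R in iid_resistances E \<mu>. finite_net_resistance V E R"
      by (rule finite_mean_resistance[OF conn \<mu> mean tr])
    show "AE R in iid_resistances E \<mu>. network_transient V E R"
      using fin AE_iid_resistances_pos[OF \<mu> countable_edges[OF countable_vertices[OF conn]]]
    proof eventually_elim
      case (elim R)
      then interpret resistor_network V E R by unfold_locales simp
      show ?case using elim network_transient_iff_resistance[OF conn] by simp
    qed
  next
    show "(\<forall>\<mu>. positive_distribution \<mu> \<longrightarrow> (AE R in iid_resistances E \<mu>. network_transient V E R)) \<longleftrightarrow>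
      (\<exists>p. 0 \<le> p \<and> p < 1 \<and> 0 < measure (bond_percolation E p)
         {\<omega> \<in> space (bond_percolation E p). has_transient_cluster V (open_edges E \<omega>)})"
      using transient_imp_percolation[OF conn] percolation_imp_transient[OF conn] by blast
  qed
qed

end
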